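(* Let $\mathbb{A}$ be a double category in which every horizontal arrow has a companion, with a choice of companion $f_*$ for each horizontal arrow $f$ such that $(1_A)_*=\mathrm{id}_A$. The objects, horizontal arrows and vertical arrows of $\mathbb{A}$, together with retrocells as cells (with the horizontal and vertical composition and identities of retrocells described in the context), form a double category $\mathbb{A}^{ret}$.
   Context: Double categories. A double category $\mathbb{A}$ has objects, horizontal arrows (composed strictly: composite $gf$, identity $1_A$), vertical arrows $v\colon A\nrightarrow C$ (composite $w\bullet v$ meaning $v$ first, identity $\mathrm{id}_A$; vertical composition is associative up to coherent isomorphism, vertical identities are taken strict) and cells. A cell has a top $f\colon A\to B$, a bottom $g\colon C\to D$ (horizontal arrows), a left side $v\colon A\nrightarrow C$ and a right side $w\colon B\nrightarrow D$ (vertical arrows). $\alpha\mid\beta$ denotes horizontal pasting ($\alpha$ left of $\beta$) and $\frac{\alpha}{\beta}$ vertical pasting ($\alpha$ above $\beta$); $1_v$ is the horizontal identity cell on $v$ and $\mathrm{id}_f$ the vertical identity cell on $f$. A globular cell $v\Rightarrow w$ is a cell with left $v$, right $w$ and identity top and bottom; globular cells are the 2-cells of the vertical bicategory $\mathcal{V}ert\,\mathbb{A}$ of $\mathbb{A}$. Associativity isomorphisms are suppressed. Companions. A companion of $f\colon A\to B$ is a vertical arrow $f_*\colon A\nrightarrow B$ with binding cells $\psi_f$ (top $1_A$, left $\mathrm{id}_A$, right $f_*$, bottom $f$) and $\chi_f$ (top $f$, left $f_*$, right $\mathrm{id}_B$, bottom $1_B$) with $\psi_f\mid\chi_f=\mathrm{id}_f$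 and $\frac{\psi_f}{\chi_f}=1_{f_*}$. The chosen companion of $1_A$ is $(\mathrm{id}_A,1_{\mathrm{id}_A},1_{\mathrm{id}_A})$. There are canonical globular isomorphisms $(hf)_*\cong h_*\bullet f_*$ determined by the binding cells. Retrocells. A retrocell $\alpha$ with top $f\colon A\to B$, left $v\colon A\nrightarrow C$, right $w\colon B\nrightarrow D$, bottom $g\colon C\to D$ is a globular cell $\alpha\colon w\bullet f_*\Rightarrow g_*\bullet v$ of $\mathbb{A}$. Horizontal composite: for $\alpha\colon w\bullet f_*\Rightarrow g_*\bullet v$ (top $f$, bottom $g$) and $\beta\colon x\bullet h_*\Rightarrow k_*\bullet w$ (top $h$, left $w$, right $x$, bottom $k$), $\beta\alpha$ is the composite $x\bullet (hf)_*\cong x\bullet h_*\bullet f_*\Rightarrow k_*\bullet w\bullet f_*\Rightarrow k_*\bullet g_*\bullet v\cong (kg)_*\bullet v$ using $\beta\bullet f_*$ then $k_*\bullet\alpha$. Vertical composite: for $\alpha\colon w\bullet f_*\Rightarrow g_*\bullet v$ and $\alpha'\colon w'\bullet g_*\Rightarrow h_*\bullet v'$ (top $g$, left $v'$, right $w'$, bottom $h$), $\alpha'\bullet\alpha$ is $w'\bullet w\bullet f_*\Rightarrow w'\bullet g_*\bullet v\Rightarrow h_*\bullet v'\bullet v$ using $w'\bullet\alpha$ then $\alpha'\bullet v$. The horizontal identity retrocell on $v$ is the identity globular cell on $v$; the vertical identity retrocell on $f$ is the identity globular cell on $f_*$. *)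

theory Defs
  imports Main
begin

text \<open>
  Double categories are strict in the horizontal direction and weak in the vertical one.  Both
  \<open>g \<odot> f\<close> (horizontal arrows) and \<open>w \<bullet> v\<close> (vertical arrows) are written in applicative order,
  whereas pastings of cells are written in diagrammatic order: \<open>\<alpha> \<parallel> \<beta>\<close> has \<open>\<alpha>\<close> to the left of
  \<open>\<beta>\<close>, and \<open>\<alpha> \<sslash> \<beta>\<close> has \<open>\<alpha>\<close> above \<open>\<beta>\<close>.  All operations are total functions, constrained only on
  composable arguments from the carriers.
\<close>

record ('o, 'h, 'v, 'c) dblcat =
  Obj :: "'o set"
  Hor :: "'h set"
  Ver :: "'v set"
  Cell :: "'c set"
  hdom :: "'h \<Rightarrow> 'o"
  hcod :: "'h \<Rightarrow> 'o"
  hid :: "'o \<Rightarrow> 'h"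
  hcomp :: "'h \<Rightarrow> 'h \<Rightarrow> 'h"  (infixl "\<odot>\<index>" 70)
  vdom :: "'v \<Rightarrow> 'o"
  vcod :: "'v \<Rightarrow> 'o"
  vid :: "'o \<Rightarrow> 'v"
  vcomp :: "'v \<Rightarrow> 'v \<Rightarrow> 'v"  (infixl "\<bullet>\<index>" 70)
  ctop :: "'c \<Rightarrow> 'h"
  cbot :: "'c \<Rightarrow> 'h"
  clft :: "'c \<Rightarrow> 'v"
  crgt :: "'c \<Rightarrow> 'v"
  hidc :: "'v \<Rightarrow> 'c"  \<comment> \<open>\<open>1\<^sub>v\<close>\<close>
  hpaste :: "'c \<Rightarrow> 'c \<Rightarrow> 'c"  (infixl "\<parallel>\<index>" 60)
  vidc :: "'h \<Rightarrow> 'c"  \<comment> \<open>\<open>id\<^sub>f\<close>\<close>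
  vpaste :: "'c \<Rightarrow> 'c \<Rightarrow> 'c"  (infixl "\<sslash>\<index>" 65)
  vassoc :: "'v \<Rightarrow> 'v \<Rightarrow> 'v \<Rightarrow> 'c"  \<comment> \<open>\<open>vassoc x w v : (x \<bullet> w) \<bullet> v \<Rightarrow> x \<bullet> (w \<bullet> v)\<close>\<close>

context
  fixes A :: "('o, 'h, 'v, 'c) dblcat" (structure)
begin

definition harr :: "'h \<Rightarrow> 'o \<Rightarrow> 'o \<Rightarrow> bool" where
  "harr f a b \<longleftrightarrow> f \<in> Hor A \<and> hdom A f = a \<and> hcod A f = b"

definition varr :: "'v \<Rightarrow> 'o \<Rightarrow> 'o \<Rightarrow> bool" where
  "varr v a c \<longleftrightarrow> v \<in> Ver A \<and> vdom A v = a \<and> vcod A v = c"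

text \<open>The order of the boundary is: top, left, right, bottom.\<close>

definition cell :: "'c \<Rightarrow> 'h \<Rightarrow> 'v \<Rightarrow> 'v \<Rightarrow> 'h \<Rightarrow> bool" where
  "cell \<alpha> f v w g \<longleftrightarrow>
     \<alpha> \<in> Cell A \<and> ctop A \<alpha> = f \<and> clft A \<alpha> = v \<and> crgt A \<alpha> = w \<and> cbot A \<alpha> = g"

definition globular :: "'c \<Rightarrow> 'v \<Rightarrow> 'v \<Rightarrow> bool" where
  "globular \<alpha> v w \<longleftrightarrow> cell \<alpha> (hid A (vdom A v)) v w (hid A (vcod A v))"

definition inverse_cells :: "'c \<Rightarrow> 'c \<Rightarrow> 'v \<Rightarrow> 'v \<Rightarrow> bool" where
  "inverse_cells \<alpha> \<beta> v w \<longleftrightarrow>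
     globular \<alpha> v w \<and> globular \<beta> w v \<and> \<alpha> \<parallel> \<beta> = hidc A v \<and> \<beta> \<parallel> \<alpha> = hidc A w"

definition globular_iso :: "'c \<Rightarrow> 'v \<Rightarrow> 'v \<Rightarrow> bool" where
  "globular_iso \<alpha> v w \<longleftrightarrow> (\<exists>\<beta>. inverse_cells \<alpha> \<beta> v w)"

definition vassoc_inv :: "'v \<Rightarrow> 'v \<Rightarrow> 'v \<Rightarrow> 'c" where
  "vassoc_inv x w v =
     (THE \<beta>. inverse_cells (vassoc A x w v) \<beta> ((x \<bullet> w) \<bullet> v) (x \<bullet> (w \<bullet> v)))"

end

locale double_category =
  fixes A :: "('o, 'h, 'v, 'c) dblcat" (structure)
  \<comment> \<open>the category of objects and horizontal arrows\<close>
  assumes hdom_obj: "f \<in> Hor A \<Longrightarrow> hdom A f \<in> Obj A"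
    and hcod_obj: "f \<in> Hor A \<Longrightarrow> hcod A f \<in> Obj A"
    and hid_arr: "a \<in> Obj A \<Longrightarrow> harr A (hid A a) a a"
    and hcomp_arr: "harr A f a b \<Longrightarrow> harr A g b c \<Longrightarrow> harr A (g \<odot> f) a c"
    and hcomp_hid: "harr A f a b \<Longrightarrow> f \<odot> hid A a = f"
    and hid_hcomp: "harr A f a b \<Longrightarrow> hid A b \<odot> f = f"
    and hcomp_assoc: "harr A f a b \<Longrightarrow> harr A g b c \<Longrightarrow> harr A h c d \<Longrightarrow>
      (h \<odot> g) \<odot> f = h \<odot> (g \<odot> f)"
  \<comment> \<open>vertical arrows, with strict identities\<close>
    and vdom_obj: "v \<in> Ver A \<Longrightarrow> vdom A v \<in> Obj A"
    and vcod_obj: "v \<in> Ver A \<Longrightarrow> vcod A v \<in> Obj A"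
    and vid_arr: "a \<in> Obj A \<Longrightarrow> varr A (vid A a) a a"
    and vcomp_arr: "varr A v a b \<Longrightarrow> varr A w b c \<Longrightarrow> varr A (w \<bullet> v) a c"
    and vcomp_vid: "varr A v a b \<Longrightarrow> v \<bullet> vid A a = v"
    and vid_vcomp: "varr A v a b \<Longrightarrow> vid A b \<bullet> v = v"
  \<comment> \<open>boundaries of cells\<close>
    and cell_boundary: "cell A \<alpha> f v w g \<Longrightarrow>
      \<exists>a b c d. harr A f a b \<and> varr A v a c \<and> varr A w b d \<and> harr A g c d"
  \<comment> \<open>the category of vertical arrows and cells, under horizontal pasting\<close>
    and hidc_cell: "varr A v a c \<Longrightarrow> cell A (hidc A v) (hid A a) v v (hid A c)"
    and hpaste_cell: "cell A \<alpha> f v w g \<Longrightarrow> cell A \<beta> h w x k \<Longrightarrow>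
      cell A (\<alpha> \<parallel> \<beta>) (h \<odot> f) v x (k \<odot> g)"
    and hidc_hpaste: "cell A \<alpha> f v w g \<Longrightarrow> hidc A v \<parallel> \<alpha> = \<alpha>"
    and hpaste_hidc: "cell A \<alpha> f v w g \<Longrightarrow> \<alpha> \<parallel> hidc A w = \<alpha>"
    and hpaste_assoc: "cell A \<alpha> f v w g \<Longrightarrow> cell A \<beta> f' w x g' \<Longrightarrow> cell A \<gamma> f'' x y g'' \<Longrightarrow>
      (\<alpha> \<parallel> \<beta>) \<parallel> \<gamma> = \<alpha> \<parallel> (\<beta> \<parallel> \<gamma>)"
  \<comment> \<open>vertical pasting, with strict identities\<close>
    and vidc_cell: "harr A f a b \<Longrightarrow> cell A (vidc A f) f (vid A a) (vid A b) f"
    and vpaste_cell: "cell A \<alpha> f v w g \<Longrightarrow> cell A \<alpha>' g v' w' h \<Longrightarrow>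
      cell A (\<alpha> \<sslash> \<alpha>') f (v' \<bullet> v) (w' \<bullet> w) h"
    and vidc_vpaste: "cell A \<alpha> f v w g \<Longrightarrow> vidc A f \<sslash> \<alpha> = \<alpha>"
    and vpaste_vidc: "cell A \<alpha> f v w g \<Longrightarrow> \<alpha> \<sslash> vidc A g = \<alpha>"
  \<comment> \<open>functoriality of vertical composition and of vertical identities\<close>
    and interchange: "cell A \<alpha> f v w g \<Longrightarrow> cell A \<beta> h w x k \<Longrightarrow>
      cell A \<alpha>' g v' w' f' \<Longrightarrow> cell A \<beta>' k w' x' h' \<Longrightarrow>
      (\<alpha> \<parallel> \<beta>) \<sslash> (\<alpha>' \<parallel> \<beta>') = (\<alpha> \<sslash> \<alpha>') \<parallel> (\<beta> \<sslash> \<beta>')"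
    and hidc_vcomp: "varr A v a b \<Longrightarrow> varr A w b c \<Longrightarrow> hidc A (w \<bullet> v) = hidc A v \<sslash> hidc A w"
    and vidc_hcomp: "harr A f a b \<Longrightarrow> harr A g b c \<Longrightarrow> vidc A (g \<odot> f) = vidc A f \<parallel> vidc A g"
    and vidc_hid: "a \<in> Obj A \<Longrightarrow> vidc A (hid A a) = hidc A (vid A a)"
  \<comment> \<open>coherent associativity of vertical composition; the unit isomorphisms are identities, so
      that the triangle equation takes the form \<open>vassoc_vid\<close>\<close>
    and vassoc_iso: "varr A v a b \<Longrightarrow> varr A w b c \<Longrightarrow> varr A x c d \<Longrightarrow>
      globular_iso A (vassoc A x w v) ((x \<bullet> w) \<bullet> v) (x \<bullet> (w \<bullet> v))"
    and vassoc_natural: "cell A \<alpha> f v w g \<Longrightarrow> cell A \<alpha>' g v' w' h \<Longrightarrow> cell A \<alpha>'' h v'' w'' k \<Longrightarrow>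
      (\<alpha> \<sslash> (\<alpha>' \<sslash> \<alpha>'')) \<parallel> vassoc A w'' w' w = vassoc A v'' v' v \<parallel> ((\<alpha> \<sslash> \<alpha>') \<sslash> \<alpha>'')"
    and vassoc_vid: "varr A v a b \<Longrightarrow> varr A w b c \<Longrightarrow>
      vassoc A w (vid A b) v = hidc A (w \<bullet> v)"
    and pentagon: "varr A v a b \<Longrightarrow> varr A w b c \<Longrightarrow> varr A x c d \<Longrightarrow> varr A y d e \<Longrightarrow>
      vassoc A (y \<bullet> x) w v \<parallel> vassoc A y x (w \<bullet> v) =
      (hidc A v \<sslash> vassoc A y x w) \<parallel> vassoc A y (x \<bullet> w) v \<parallel> (vassoc A x w v \<sslash> hidc A y)"


subsection \<open>Companions\<close>

definition companion ::
  "('o, 'h, 'v, 'c) dblcat \<Rightarrow> 'h \<Rightarrow> 'v \<Rightarrow> 'c \<Rightarrow> 'c \<Rightarrow> bool" where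
  "companion A f p \<psi> \<chi> \<longleftrightarrow>
     varr A p (hdom A f) (hcod A f) \<and>
     cell A \<psi> (hid A (hdom A f)) (vid A (hdom A f)) p f \<and>
     cell A \<chi> f p (vid A (hcod A f)) (hid A (hcod A f)) \<and>
     \<psi> \<parallel>\<^bsub>A\<^esub> \<chi> = vidc A f \<and>
     \<psi> \<sslash>\<^bsub>A\<^esub> \<chi> = hidc A p"

record ('h, 'v, 'c) companions =
  cmp :: "'h \<Rightarrow> 'v"
  psi :: "'h \<Rightarrow> 'c"
  chi :: "'h \<Rightarrow> 'c"

definition companion_choice ::
  "('o, 'h, 'v, 'c) dblcat \<Rightarrow> ('h, 'v, 'c) companions \<Rightarrow> bool" where
  "companion_choice A K \<longleftrightarrow>
     (\<forall>f\<in>Hor A. companion A f (cmp K f) (psi K f) (chi K f)) \<and>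
     (\<forall>a\<in>Obj A. cmp K (hid A a) = vid A a \<and>
                psi K (hid A a) = hidc A (vid A a) \<and>
                chi K (hid A a) = hidc A (vid A a))"


subsection \<open>Retrocells\<close>

datatype ('h, 'v, 'c) retro =
  Retro (rtop: 'h) (rlft: 'v) (rrgt: 'v) (rbot: 'h) (rcell: 'c)

context
  fixes A :: "('o, 'h, 'v, 'c) dblcat" (structure)
    and K :: "('h, 'v, 'c) companions"
begin

text \<open>
  The canonical isomorphism \<open>(h f)\<^sub>* \<Rightarrow> h\<^sub>* \<bullet> f\<^sub>*\<close> and its inverse.  The binding cells
  \<open>\<psi>\<^sub>f \<sslash> (id\<^sub>f \<parallel> \<psi>\<^sub>h)\<close> and \<open>(\<chi>\<^sub>f \<parallel> id\<^sub>h) \<sslash> \<chi>\<^sub>h\<close> make \<open>h\<^sub>* \<bullet> f\<^sub>*\<close> a companion of \<open>h f\<close>; the two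
  comparison cells paste one of these with \<open>\<chi>\<close>, respectively \<open>\<psi>\<close>, of \<open>h f\<close>.
\<close>

definition cmp_split :: "'h \<Rightarrow> 'h \<Rightarrow> 'c" where
  "cmp_split h f = (psi K f \<sslash> (vidc A f \<parallel> psi K h)) \<sslash> chi K (h \<odot> f)"

definition cmp_merge :: "'h \<Rightarrow> 'h \<Rightarrow> 'c" where
  "cmp_merge h f = psi K (h \<odot> f) \<sslash> ((chi K f \<parallel> vidc A h) \<sslash> chi K h)"

definition retrocells :: "('h, 'v, 'c) retro set" where
  "retrocells = {Retro f v w g \<alpha> | f v w g \<alpha>.
     \<exists>a b c d. harr A f a b \<and> varr A v a c \<and> varr A w b d \<and> harr A g c d \<and>
       globular A \<alpha> (w \<bullet> cmp K f) (cmp K g \<bullet> v)}"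

definition retro_hidc :: "'v \<Rightarrow> ('h, 'v, 'c) retro" where
  "retro_hidc v = Retro (hid A (vdom A v)) v v (hid A (vcod A v)) (hidc A v)"

definition retro_vidc :: "'h \<Rightarrow> ('h, 'v, 'c) retro" where
  "retro_vidc f = Retro f (vid A (hdom A f)) (vid A (hcod A f)) f (hidc A (cmp K f))"

text \<open>
  The globular cell underlying a horizontal composite is
  \<open>x \<bullet> (h f)\<^sub>* \<Rightarrow> x \<bullet> (h\<^sub>* \<bullet> f\<^sub>*) \<Rightarrow> (x \<bullet> h\<^sub>*) \<bullet> f\<^sub>* \<Rightarrow> (k\<^sub>* \<bullet> w) \<bullet> f\<^sub>* \<Rightarrow> k\<^sub>* \<bullet> (w \<bullet> f\<^sub>*) \<Rightarrow>
  k\<^sub>* \<bullet> (g\<^sub>* \<bullet> v) \<Rightarrow> (k\<^sub>* \<bullet> g\<^sub>*) \<bullet> v \<Rightarrow> (k g)\<^sub>* \<bullet> v\<close>.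
\<close>

fun retro_hpaste :: "('h, 'v, 'c) retro \<Rightarrow> ('h, 'v, 'c) retro \<Rightarrow> ('h, 'v, 'c) retro" where
  "retro_hpaste (Retro f v w g \<alpha>) (Retro h w' x k \<beta>) =
     Retro (h \<odot> f) v x (k \<odot> g)
       ((cmp_split h f \<sslash> hidc A x)
        \<parallel> vassoc_inv A x (cmp K h) (cmp K f)
        \<parallel> (hidc A (cmp K f) \<sslash> \<beta>)
        \<parallel> vassoc A (cmp K k) w (cmp K f)
        \<parallel> (\<alpha> \<sslash> hidc A (cmp K k))
        \<parallel> vassoc_inv A (cmp K k) (cmp K g) v
        \<parallel> (hidc A v \<sslash> cmp_merge k g))"

text \<open>
  The globular cell underlying a vertical composite is
  \<open>(w' \<bullet> w) \<bullet> f\<^sub>* \<Rightarrow> w' \<bullet> (w \<bullet> f\<^sub>*) \<Rightarrow> w' \<bullet> (g\<^sub>* \<bullet> v) \<Rightarrow> (w' \<bullet> g\<^sub>*) \<bullet> v \<Rightarrow> (h\<^sub>* \<bullet> v') \<bullet> v \<Rightarrow>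
  h\<^sub>* \<bullet> (v' \<bullet> v)\<close>.
\<close>

fun retro_vpaste :: "('h, 'v, 'c) retro \<Rightarrow> ('h, 'v, 'c) retro \<Rightarrow> ('h, 'v, 'c) retro" where
  "retro_vpaste (Retro f v w g \<alpha>) (Retro g' v' w' h \<alpha>') =
     Retro f (v' \<bullet> v) (w' \<bullet> w) h
       (vassoc A w' w (cmp K f)
        \<parallel> (\<alpha> \<sslash> hidc A w')
        \<parallel> vassoc_inv A w' (cmp K g) v
        \<parallel> (hidc A v \<sslash> \<alpha>')
        \<parallel> vassoc A (cmp K h) v' v)"

text \<open>
  Since \<open>(1\<^sub>A)\<^sub>* = id\<^sub>A\<close>, a retrocell with identity top and bottom, left side \<open>v\<close> and right side \<open>w\<close> is a
  globular cell \<open>w \<Rightarrow> v\<close>, so the associator is the inverse of the original one.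
\<close>

definition retro_vassoc :: "'v \<Rightarrow> 'v \<Rightarrow> 'v \<Rightarrow> ('h, 'v, 'c) retro" where
  "retro_vassoc x w v =
     Retro (hid A (vdom A v)) ((x \<bullet> w) \<bullet> v) (x \<bullet> (w \<bullet> v)) (hid A (vcod A x)) (vassoc_inv A x w v)"

definition Ret :: "('o, 'h, 'v, ('h, 'v, 'c) retro) dblcat" where
  "Ret = \<lparr>
     Obj = Obj A, Hor = Hor A, Ver = Ver A, Cell = retrocells,
     hdom = hdom A, hcod = hcod A, hid = hid A, hcomp = hcomp A,
     vdom = vdom A, vcod = vcod A, vid = vid A, vcomp = vcomp A,
     ctop = rtop, cbot = rbot, clft = rlft, crgt = rrgt,
     hidc = retro_hidc, hpaste = retro_hpaste,
     vidc = retro_vidc, vpaste = retro_vpaste,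
     vassoc = retro_vassoc\<rparr>"

end

end

theory Submission
  imports Defs
begin

text \<open>
A retrocell is a square in the vertical bicategory whose horizontal sides happen to be companions,
so the laws of a double category for retrocells would be immediate pasting equations if vertical
composition were strictly associative.  The difficulty is to control the associators.  The device
used for this is a Cayley representation: a globular cell \<open>\<alpha> : w \<bullet> f \<Rightarrow> g \<bullet> v\<close> is replaced by the
family of its components \<open>\<alpha>\<^sup>y : w \<bullet> (f \<bullet> y) \<Rightarrow> g \<bullet> (v \<bullet> y)\<close>, one for each vertical arrow \<open>y\<close> that
ends where \<open>f\<close> and \<open>v\<close> start.  The component at an identity is \<open>\<alpha>\<close> itself (\<open>component_vid\<close>), so
squares may be compared component by component (\<open>square_eqI\<close>), and components are natural in \<open>y\<close>
(\<open>component_natural\<close>).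

What is gained is that iterated composites of vertical arrows now act one after the other, bracketed
to the right.  The pentagon lets all associators inside the two composites of retrocells cancel
(\<open>component_hcomp\<close>, \<open>component_vcomp\<close>), so that, with \<open>u \<triangleright> _\<close> for whiskering by \<open>u\<close> on the left,
\<open>(\<beta> \<alpha>)\<^sup>y\<close> is \<open>x \<triangleright> split\<close>, then \<open>\<beta>\<close> at \<open>f\<^sub>* \<bullet> y\<close>, then \<open>k\<^sub>* \<triangleright> \<alpha>\<^sup>y\<close>, then \<open>merge\<close>,
where \<open>split\<close> and \<open>merge\<close> are the components of the comparison cells \<open>(h f)\<^sub>* \<cong> h\<^sub>* \<bullet> f\<^sub>*\<close>, and
vertical composition is \<open>w' \<triangleright> \<alpha>\<^sup>y\<close> followed by \<open>\<alpha>'\<close> at \<open>v \<bullet> y\<close>, up to one associator at either end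
which only regroups \<open>w' \<bullet> w\<close> and \<open>v' \<bullet> v\<close>.  Associativity of horizontal pasting, interchange and
naturality of the associator then reduce to naturality of components together with the pentagon.

Two ingredients remain.  The associator is trivial as soon as one of its arguments is an identity,
wherever this identity stands; only the middle position is an axiom, and the outer ones follow from
the pentagon (\<open>vassoc_unit\<close>).  The comparison cells for companions are inverse to one another and
coherent (\<open>cmp_split_merge\<close>, \<open>cmp_split_assoc\<close>), because a globular cell out of a companion \<open>f\<^sub>*\<close> is
determined by its paste with the binding cell \<open>\<psi>\<^sub>f\<close> (\<open>companion_eqI\<close>), and for the cells in question
that paste can be computed by interchange.
\<close>

section \<open>Globular cells and whiskering\<close>

context double_category
begin

text \<open>
Globular cells are handled through their two sides \<open>clft A \<alpha>\<close> and \<open>crgt A \<alpha>\<close> rather than through a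
typing judgement \<open>globular A \<alpha> v w\<close>: the side conditions of conditional rewrite rules then contain no
variable that matching leaves open, and the simplifier can discharge them.
\<close>

definition glob :: "'c \<Rightarrow> bool" where
  "glob \<alpha> \<longleftrightarrow> globular A \<alpha> (clft A \<alpha>) (crgt A \<alpha>)"

definition whisk_left :: "'v \<Rightarrow> 'c \<Rightarrow> 'c"  (infixr "\<triangleright>" 75) where
  "u \<triangleright> \<alpha> = \<alpha> \<sslash> hidc A u"

definition whisk_right :: "'c \<Rightarrow> 'v \<Rightarrow> 'c"  (infixl "\<triangleleft>" 75) where
  "\<alpha> \<triangleleft> x = hidc A x \<sslash> \<alpha>"

lemma globular_iff: "globular A \<alpha> v w \<longleftrightarrow> glob \<alpha> \<and> clft A \<alpha> = v \<and> crgt A \<alpha> = w"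
  by (auto simp: glob_def globular_def cell_def)

lemma varr_self: "v \<in> Ver A \<Longrightarrow> varr A v (vdom A v) (vcod A v)"
  by (simp add: varr_def)

lemma varr_obj: "varr A v a c \<Longrightarrow> a \<in> Obj A" "varr A v a c \<Longrightarrow> c \<in> Obj A"
  using vdom_obj vcod_obj by (auto simp: varr_def)

text \<open>
The boundary of a cell closes up, so a cell with identity top and bottom connects parallel vertical
arrows.
\<close>

lemma glob_sides:
  assumes "glob \<alpha>"
  shows "clft A \<alpha> \<in> Ver A" "crgt A \<alpha> \<in> Ver A"
    "vdom A (crgt A \<alpha>) = vdom A (clft A \<alpha>)" "vcod A (crgt A \<alpha>) = vcod A (clft A \<alpha>)"
proof -
  have c: "cell A \<alpha> (hid A (vdom A (clft A \<alpha>))) (clft A \<alpha>) (crgt A \<alpha>) (hid A (vcod A (clft A \<alpha>)))"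
    using assms by (simp add: glob_def globular_def)
  obtain a b c d where bd: "harr A (hid A (vdom A (clft A \<alpha>))) a b" "varr A (clft A \<alpha>) a c"
    "varr A (crgt A \<alpha>) b d" "harr A (hid A (vcod A (clft A \<alpha>))) c d"
    using cell_boundary[OF c] by blast
  then show "clft A \<alpha> \<in> Ver A" "crgt A \<alpha> \<in> Ver A" by (auto simp: varr_def)
  have "a \<in> Obj A" "c \<in> Obj A" using bd vdom_obj vcod_obj by (auto simp: varr_def)
  then show "vdom A (crgt A \<alpha>) = vdom A (clft A \<alpha>)" "vcod A (crgt A \<alpha>) = vcod A (clft A \<alpha>)"
    using bd hid_arr[of a] hid_arr[of c] by (auto simp: varr_def harr_def)
qed

lemma glob_cell:
  assumes "glob \<alpha>"
  shows "cell A \<alpha> (hid A (vdom A (clft A \<alpha>))) (clft A \<alpha>) (crgt A \<alpha>) (hid A (vcod A (clft A \<alpha>)))"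
  using assms by (simp add: glob_def globular_def)

lemma globI:
  assumes "cell A \<alpha> (hid A a) v w (hid A c)" "vdom A v = a" "vcod A v = c"
  shows "glob \<alpha>" "clft A \<alpha> = v" "crgt A \<alpha> = w"
  using assms by (auto simp: glob_def globular_def cell_def)

lemma vid_simps [simp]:
  assumes "a \<in> Obj A"
  shows "vid A a \<in> Ver A" "vdom A (vid A a) = a" "vcod A (vid A a) = a"
  using vid_arr[OF assms] by (auto simp: varr_def)

lemma hid_simps [simp]:
  assumes "a \<in> Obj A"
  shows "hid A a \<in> Hor A" "hdom A (hid A a) = a" "hcod A (hid A a) = a"
  using hid_arr[OF assms] by (auto simp: harr_def)

lemma vcomp_simps [simp]:
  assumes "v \<in> Ver A" "w \<in> Ver A" "vcod A v = vdom A w"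
  shows "w \<bullet> v \<in> Ver A" "vdom A (w \<bullet> v) = vdom A v" "vcod A (w \<bullet> v) = vcod A w"
  using vcomp_arr[of v _ _ w] assms by (auto simp: varr_def)

lemma vcomp_vid_simps [simp]:
  assumes "v \<in> Ver A"
  shows "vdom A v = a \<Longrightarrow> v \<bullet> vid A a = v" "vcod A v = c \<Longrightarrow> vid A c \<bullet> v = v"
  using assms vcomp_vid vid_vcomp by (auto simp: varr_def)

lemma vert_obj [simp]:
  assumes "v \<in> Ver A"
  shows "vdom A v \<in> Obj A" "vcod A v \<in> Obj A"
  using assms vdom_obj vcod_obj by auto

lemma hidc_simps [simp]:
  assumes "v \<in> Ver A"
  shows "glob (hidc A v)" "clft A (hidc A v) = v" "crgt A (hidc A v) = v"
  using globI[OF hidc_cell[OF varr_self[OF assms]]] by auto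

lemma hpaste_simps [simp]:
  assumes "glob \<alpha>" "glob \<beta>" "crgt A \<alpha> = clft A \<beta>"
  shows "glob (\<alpha> \<parallel> \<beta>)" "clft A (\<alpha> \<parallel> \<beta>) = clft A \<alpha>" "crgt A (\<alpha> \<parallel> \<beta>) = crgt A \<beta>"
proof -
  let ?a = "vdom A (clft A \<alpha>)" and ?c = "vcod A (clft A \<alpha>)"
  note s = glob_sides[OF assms(1)] glob_sides[OF assms(2)]
  have "cell A (\<alpha> \<parallel> \<beta>) (hid A ?a \<odot> hid A ?a) (clft A \<alpha>) (crgt A \<beta>) (hid A ?c \<odot> hid A ?c)"
    using hpaste_cell[OF glob_cell[OF assms(1)]] glob_cell[OF assms(2)] assms(3) s by auto
  moreover have "hid A ?a \<odot> hid A ?a = hid A ?a" "hid A ?c \<odot> hid A ?c = hid A ?c"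
    using hcomp_hid[OF hid_arr] s by auto
  ultimately show "glob (\<alpha> \<parallel> \<beta>)" "clft A (\<alpha> \<parallel> \<beta>) = clft A \<alpha>" "crgt A (\<alpha> \<parallel> \<beta>) = crgt A \<beta>"
    using globI[of "\<alpha> \<parallel> \<beta>"] by auto
qed

lemma glob_assoc:
  assumes "glob \<alpha>" "glob \<beta>" "glob \<gamma>" "crgt A \<alpha> = clft A \<beta>" "crgt A \<beta> = clft A \<gamma>"
  shows "(\<alpha> \<parallel> \<beta>) \<parallel> \<gamma> = \<alpha> \<parallel> (\<beta> \<parallel> \<gamma>)"
  by (metis assms hpaste_assoc glob_cell)

lemma glob_unit [simp]:
  assumes "glob \<alpha>"
  shows "clft A \<alpha> = v \<Longrightarrow> hidc A v \<parallel> \<alpha> = \<alpha>" "crgt A \<alpha> = w \<Longrightarrow> \<alpha> \<parallel> hidc A w = \<alpha>"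
  using hidc_hpaste[OF glob_cell[OF assms]] hpaste_hidc[OF glob_cell[OF assms]] by auto

lemma glob_vpaste:
  assumes "glob \<alpha>" "glob \<beta>" "vcod A (clft A \<alpha>) = vdom A (clft A \<beta>)"
  shows "glob (\<alpha> \<sslash> \<beta>)" "clft A (\<alpha> \<sslash> \<beta>) = clft A \<beta> \<bullet> clft A \<alpha>"
    "crgt A (\<alpha> \<sslash> \<beta>) = crgt A \<beta> \<bullet> crgt A \<alpha>"
  using globI[OF vpaste_cell[OF glob_cell[OF assms(1)] glob_cell[OF assms(2), folded assms(3)]]]
    glob_sides[OF assms(1)] glob_sides[OF assms(2)] assms(3)
  by auto

lemma glob_interchange:
  assumes "glob \<alpha>" "glob \<beta>" "glob \<alpha>'" "glob \<beta>'"
    "crgt A \<alpha> = clft A \<beta>" "crgt A \<alpha>' = clft A \<beta>'" "vcod A (clft A \<alpha>) = vdom A (clft A \<alpha>')"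
  shows "(\<alpha> \<parallel> \<beta>) \<sslash> (\<alpha>' \<parallel> \<beta>') = (\<alpha> \<sslash> \<alpha>') \<parallel> (\<beta> \<sslash> \<beta>')"
proof -
  have "vcod A (clft A \<beta>) = vdom A (clft A \<beta>')"
    using assms glob_sides by metis
  then show ?thesis
    by (metis assms glob_cell glob_sides interchange)
qed

lemma whisk_left_simps [simp]:
  assumes "u \<in> Ver A" "glob \<alpha>" "vcod A (clft A \<alpha>) = vdom A u"
  shows "glob (u \<triangleright> \<alpha>)" "clft A (u \<triangleright> \<alpha>) = u \<bullet> clft A \<alpha>" "crgt A (u \<triangleright> \<alpha>) = u \<bullet> crgt A \<alpha>"
  using glob_vpaste[of \<alpha> "hidc A u"] assms by (simp_all add: whisk_left_def)

lemma whisk_right_simps [simp]: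
  assumes "x \<in> Ver A" "glob \<alpha>" "vcod A x = vdom A (clft A \<alpha>)"
  shows "glob (\<alpha> \<triangleleft> x)" "clft A (\<alpha> \<triangleleft> x) = clft A \<alpha> \<bullet> x" "crgt A (\<alpha> \<triangleleft> x) = crgt A \<alpha> \<bullet> x"
  using glob_vpaste[of "hidc A x" \<alpha>] assms by (simp_all add: whisk_right_def)

lemma whisk_left_hpaste:
  assumes "u \<in> Ver A" "glob \<alpha>" "glob \<beta>" "crgt A \<alpha> = clft A \<beta>" "vcod A (clft A \<alpha>) = vdom A u"
  shows "u \<triangleright> (\<alpha> \<parallel> \<beta>) = (u \<triangleright> \<alpha>) \<parallel> (u \<triangleright> \<beta>)"
  using glob_interchange[of \<alpha> \<beta> "hidc A u" "hidc A u"] assms by (simp add: whisk_left_def)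

lemma whisk_right_hpaste:
  assumes "x \<in> Ver A" "glob \<alpha>" "glob \<beta>" "crgt A \<alpha> = clft A \<beta>" "vcod A x = vdom A (clft A \<alpha>)"
  shows "(\<alpha> \<parallel> \<beta>) \<triangleleft> x = (\<alpha> \<triangleleft> x) \<parallel> (\<beta> \<triangleleft> x)"
  using glob_interchange[of "hidc A x" "hidc A x" \<alpha> \<beta>] assms by (simp add: whisk_right_def)

lemma whisk_hidc [simp]:
  assumes "v \<in> Ver A" "w \<in> Ver A" "vcod A v = vdom A w"
  shows "w \<triangleright> hidc A v = hidc A (w \<bullet> v)" "hidc A w \<triangleleft> v = hidc A (w \<bullet> v)"
  using assms hidc_vcomp[of v _ _ w] by (auto simp: whisk_left_def whisk_right_def varr_def)

lemma whisk_vid [simp]: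
  assumes "glob \<alpha>"
  shows "vcod A (clft A \<alpha>) = a \<Longrightarrow> vid A a \<triangleright> \<alpha> = \<alpha>" "vdom A (clft A \<alpha>) = b \<Longrightarrow> \<alpha> \<triangleleft> vid A b = \<alpha>"
  using vpaste_vidc[OF glob_cell[OF assms]] vidc_vpaste[OF glob_cell[OF assms]]
    vidc_hid glob_sides[OF assms]
  by (auto simp: whisk_left_def whisk_right_def)

text \<open>
Both composites are the vertical paste \<open>\<xi> \<sslash> \<alpha>\<close>, by interchange with identity cells.
\<close>

lemma whisk_exchange:
  assumes "glob \<alpha>" "glob \<xi>" "vcod A (clft A \<xi>) = vdom A (clft A \<alpha>)"
  shows "(\<alpha> \<triangleleft> clft A \<xi>) \<parallel> (crgt A \<alpha> \<triangleright> \<xi>) = (clft A \<alpha> \<triangleright> \<xi>) \<parallel> (\<alpha> \<triangleleft> crgt A \<xi>)"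
proof -
  note s = glob_sides[OF assms(1)] glob_sides[OF assms(2)]
  have "(\<alpha> \<triangleleft> clft A \<xi>) \<parallel> (crgt A \<alpha> \<triangleright> \<xi>) = \<xi> \<sslash> \<alpha>"
    using glob_interchange[of "hidc A (clft A \<xi>)" \<xi> \<alpha> "hidc A (crgt A \<alpha>)"] assms s
    by (simp add: whisk_left_def whisk_right_def)
  moreover have "(clft A \<alpha> \<triangleright> \<xi>) \<parallel> (\<alpha> \<triangleleft> crgt A \<xi>) = \<xi> \<sslash> \<alpha>"
    using glob_interchange[of \<xi> "hidc A (crgt A \<xi>)" "hidc A (clft A \<alpha>)" \<alpha>] assms s
    by (simp add: whisk_left_def whisk_right_def)
  ultimately show ?thesis by simp
qed

section \<open>The associator and its coherence\<close>

lemma inverse_cells_unique: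
  assumes "inverse_cells A \<alpha> \<beta> v w" "inverse_cells A \<alpha> \<beta>' v w"
  shows "\<beta> = \<beta>'"
proof -
  have "\<beta> = \<beta> \<parallel> (\<alpha> \<parallel> \<beta>')" "\<beta>' = (\<beta> \<parallel> \<alpha>) \<parallel> \<beta>'"
    using assms by (auto simp: inverse_cells_def globular_iff)
  then show ?thesis
    using assms glob_assoc[of \<beta> \<alpha> \<beta>'] by (auto simp: inverse_cells_def globular_iff)
qed

text \<open>
Justifies the definite description in the definition of \<open>vassoc_inv\<close>.
\<close>

lemma vassoc_inverse:
  assumes "v \<in> Ver A" "w \<in> Ver A" "x \<in> Ver A" "vcod A v = vdom A w" "vcod A w = vdom A x"
  shows "inverse_cells A (vassoc A x w v) (vassoc_inv A x w v) ((x \<bullet> w) \<bullet> v) (x \<bullet> (w \<bullet> v))"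
proof -
  obtain \<beta> where b: "inverse_cells A (vassoc A x w v) \<beta> ((x \<bullet> w) \<bullet> v) (x \<bullet> (w \<bullet> v))"
    using vassoc_iso[OF varr_self[of v], of w "vcod A w" x "vcod A x"] assms
    by (auto simp: varr_def globular_iso_def)
  then have "vassoc_inv A x w v = \<beta>"
    unfolding vassoc_inv_def by (blast intro: the_equality inverse_cells_unique)
  with b show ?thesis by simp
qed

lemma vassoc_simps [simp]:
  assumes "v \<in> Ver A" "w \<in> Ver A" "x \<in> Ver A" "vcod A v = vdom A w" "vcod A w = vdom A x"
  shows "glob (vassoc A x w v)" "glob (vassoc_inv A x w v)"
    "clft A (vassoc A x w v) = (x \<bullet> w) \<bullet> v" "crgt A (vassoc A x w v) = x \<bullet> (w \<bullet> v)"
    "clft A (vassoc_inv A x w v) = x \<bullet> (w \<bullet> v)" "crgt A (vassoc_inv A x w v) = (x \<bullet> w) \<bullet> v"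
    "vassoc A x w v \<parallel> vassoc_inv A x w v = hidc A ((x \<bullet> w) \<bullet> v)"
    "vassoc_inv A x w v \<parallel> vassoc A x w v = hidc A (x \<bullet> (w \<bullet> v))"
  using vassoc_inverse[OF assms] by (auto simp: inverse_cells_def globular_iff)

text \<open>
Turns an equation between pastings of two cells into one that applies in front of a remaining
paste \<open>R\<close>.  With it, every equation serves as a rewrite rule on right-nested chains of globular
cells.
\<close>

lemma hpaste_tail:
  assumes "X \<parallel> Y = Z" "glob X" "glob Y" "glob R" "crgt A X = clft A Y" "crgt A Y = clft A R"
  shows "X \<parallel> (Y \<parallel> R) = Z \<parallel> R"
  using assms glob_assoc[of X Y R] by simp

lemma vassoc_cancel_tail [simp]:
  assumes "v \<in> Ver A" "w \<in> Ver A" "x \<in> Ver A" "vcod A v = vdom A w" "vcod A w = vdom A x" "glob R"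
  shows "clft A R = (x \<bullet> w) \<bullet> v \<Longrightarrow> vassoc A x w v \<parallel> (vassoc_inv A x w v \<parallel> R) = R"
    "clft A R = x \<bullet> (w \<bullet> v) \<Longrightarrow> vassoc_inv A x w v \<parallel> (vassoc A x w v \<parallel> R) = R"
  using assms hpaste_tail[of "vassoc A x w v" "vassoc_inv A x w v" _ R]
    hpaste_tail[of "vassoc_inv A x w v" "vassoc A x w v" _ R] by auto

lemma vassoc_natural_glob:
  assumes "glob \<alpha>" "glob \<beta>" "glob \<gamma>"
    "vcod A (clft A \<alpha>) = vdom A (clft A \<beta>)" "vcod A (clft A \<beta>) = vdom A (clft A \<gamma>)"
  shows "vassoc A (clft A \<gamma>) (clft A \<beta>) (clft A \<alpha>) \<parallel> ((\<alpha> \<sslash> \<beta>) \<sslash> \<gamma>)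
    = (\<alpha> \<sslash> (\<beta> \<sslash> \<gamma>)) \<parallel> vassoc A (crgt A \<gamma>) (crgt A \<beta>) (crgt A \<alpha>)"
  using vassoc_natural[OF glob_cell[OF assms(1)] glob_cell[OF assms(2), folded assms(4)]
      glob_cell[OF assms(3), folded assms(5)]] by simp

lemma vassoc_inv_natural_glob:
  assumes "glob \<alpha>" "glob \<beta>" "glob \<gamma>"
    "vcod A (clft A \<alpha>) = vdom A (clft A \<beta>)" "vcod A (clft A \<beta>) = vdom A (clft A \<gamma>)"
  shows "vassoc_inv A (clft A \<gamma>) (clft A \<beta>) (clft A \<alpha>) \<parallel> (\<alpha> \<sslash> (\<beta> \<sslash> \<gamma>))
    = ((\<alpha> \<sslash> \<beta>) \<sslash> \<gamma>) \<parallel> vassoc_inv A (crgt A \<gamma>) (crgt A \<beta>) (crgt A \<alpha>)"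
    (is "?a' \<parallel> ?P = ?Q \<parallel> ?b'")
proof -
  note [simp] = assms glob_sides[OF assms(1)] glob_sides[OF assms(2)] glob_sides[OF assms(3)]
    glob_vpaste
  have "?a' \<parallel> ?P = ?a' \<parallel> ((?P \<parallel> vassoc A (crgt A \<gamma>) (crgt A \<beta>) (crgt A \<alpha>)) \<parallel> ?b')"
    by (simp add: glob_assoc)
  also have "\<dots> = ?Q \<parallel> ?b'"
    by (simp add: vassoc_natural_glob[OF assms, symmetric] glob_assoc)
  finally show ?thesis .
qed

lemma hidc_vpaste_hidc:
  assumes "v \<in> Ver A" "w \<in> Ver A" "vcod A v = vdom A w"
  shows "hidc A v \<sslash> hidc A w = hidc A (w \<bullet> v)"
  using whisk_hidc(1)[OF assms] by (simp add: whisk_left_def)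

text \<open>
Naturality of the associator in one argument at a time.
\<close>

lemma vassoc_whisk:
  assumes "glob \<alpha>" "clft A \<alpha> = p" "crgt A \<alpha> = q"
  shows "x \<in> Ver A \<Longrightarrow> w \<in> Ver A \<Longrightarrow> vcod A p = vdom A w \<Longrightarrow> vcod A w = vdom A x \<Longrightarrow>
      vassoc A x w p \<parallel> (x \<triangleright> (w \<triangleright> \<alpha>)) = ((x \<bullet> w) \<triangleright> \<alpha>) \<parallel> vassoc A x w q"
    and "x \<in> Ver A \<Longrightarrow> v \<in> Ver A \<Longrightarrow> vcod A v = vdom A p \<Longrightarrow> vcod A p = vdom A x \<Longrightarrow>
      vassoc A x p v \<parallel> (x \<triangleright> (\<alpha> \<triangleleft> v)) = ((x \<triangleright> \<alpha>) \<triangleleft> v) \<parallel> vassoc A x q v"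
    and "w \<in> Ver A \<Longrightarrow> v \<in> Ver A \<Longrightarrow> vcod A v = vdom A w \<Longrightarrow> vcod A w = vdom A p \<Longrightarrow>
      vassoc A p w v \<parallel> (\<alpha> \<triangleleft> (w \<bullet> v)) = ((\<alpha> \<triangleleft> w) \<triangleleft> v) \<parallel> vassoc A q w v"
  using vassoc_natural_glob[of \<alpha> "hidc A w" "hidc A x"] vassoc_natural_glob[of "hidc A v" \<alpha> "hidc
      A x"]
    vassoc_natural_glob[of "hidc A v" "hidc A w" \<alpha>] assms glob_sides[OF assms(1)]
  by (simp_all add: whisk_left_def whisk_right_def hidc_vpaste_hidc)

lemma vassoc_inv_whisk:
  assumes "glob \<alpha>" "clft A \<alpha> = p" "crgt A \<alpha> = q"
  shows "x \<in> Ver A \<Longrightarrow> w \<in> Ver A \<Longrightarrow> vcod A p = vdom A w \<Longrightarrow> vcod A w = vdom A x \<Longrightarrow>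
      vassoc_inv A x w p \<parallel> ((x \<bullet> w) \<triangleright> \<alpha>) = (x \<triangleright> (w \<triangleright> \<alpha>)) \<parallel> vassoc_inv A x w q"
    and "x \<in> Ver A \<Longrightarrow> v \<in> Ver A \<Longrightarrow> vcod A v = vdom A p \<Longrightarrow> vcod A p = vdom A x \<Longrightarrow>
      vassoc_inv A x p v \<parallel> ((x \<triangleright> \<alpha>) \<triangleleft> v) = (x \<triangleright> (\<alpha> \<triangleleft> v)) \<parallel> vassoc_inv A x q v"
    and "w \<in> Ver A \<Longrightarrow> v \<in> Ver A \<Longrightarrow> vcod A v = vdom A w \<Longrightarrow> vcod A w = vdom A p \<Longrightarrow>
      vassoc_inv A p w v \<parallel> ((\<alpha> \<triangleleft> w) \<triangleleft> v) = (\<alpha> \<triangleleft> (w \<bullet> v)) \<parallel> vassoc_inv A q w v"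
  using vassoc_inv_natural_glob[of \<alpha> "hidc A w" "hidc A x"] vassoc_inv_natural_glob[of "hidc A v"
      \<alpha> "hidc A x"]
    vassoc_inv_natural_glob[of "hidc A v" "hidc A w" \<alpha>] assms glob_sides[OF assms(1)]
  by (simp_all add: whisk_left_def whisk_right_def hidc_vpaste_hidc)

lemma pentagon_whisk:
  assumes "v \<in> Ver A" "w \<in> Ver A" "x \<in> Ver A" "y \<in> Ver A"
    "vcod A v = vdom A w" "vcod A w = vdom A x" "vcod A x = vdom A y"
  shows "(vassoc A y x w \<triangleleft> v) \<parallel> (vassoc A y (x \<bullet> w) v \<parallel> (y \<triangleright> vassoc A x w v))
    = vassoc A (y \<bullet> x) w v \<parallel> vassoc A y x (w \<bullet> v)"
  using pentagon[OF varr_self[of v], of w "vcod A w" x "vcod A x" y "vcod A y"] assms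
  by (simp add: whisk_left_def[symmetric] whisk_right_def[symmetric] varr_def glob_assoc)

text \<open>
The pentagon with an inverse associator moved past a whiskered cell.  Together with
\<open>vassoc_inv_whisk\<close>, this says how an inverse associator standing at the left of a chain of globular
cells travels to the right.
\<close>

lemma pentagon_split:
  assumes "v \<in> Ver A" "w \<in> Ver A" "x \<in> Ver A" "y \<in> Ver A"
    "vcod A v = vdom A w" "vcod A w = vdom A x" "vcod A x = vdom A y"
  shows "vassoc_inv A y (x \<bullet> w) v \<parallel> (vassoc_inv A y x w \<triangleleft> v)
     = (y \<triangleright> vassoc A x w v) \<parallel> (vassoc_inv A y x (w \<bullet> v) \<parallel> vassoc_inv A (y \<bullet> x) w v)" (is "?L =
         ?R")
    and "vassoc_inv A (y \<bullet> x) w v \<parallel> (vassoc A y x w \<triangleleft> v)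
     = vassoc A y x (w \<bullet> v) \<parallel> ((y \<triangleright> vassoc_inv A x w v) \<parallel> vassoc_inv A y (x \<bullet> w) v)" (is "?L' =
         ?R'")
proof -
  let ?p = "vassoc A y x w \<triangleleft> v" and ?p' = "vassoc_inv A y x w \<triangleleft> v"
  let ?q = "y \<triangleright> vassoc A x w v" and ?q' = "y \<triangleright> vassoc_inv A x w v"
  have pp: "?p \<parallel> ?p' = hidc A (((y \<bullet> x) \<bullet> w) \<bullet> v)" "?p' \<parallel> ?p = hidc A ((y \<bullet> (x \<bullet> w)) \<bullet> v)"
    using assms by (simp_all flip: whisk_right_hpaste)
  have qq: "?q \<parallel> ?q' = hidc A (y \<bullet> ((x \<bullet> w) \<bullet> v))" "?q' \<parallel> ?q = hidc A (y \<bullet> (x \<bullet> (w \<bullet> v)))"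
    using assms by (simp_all flip: whisk_left_hpaste)
  note pent = pentagon_whisk[OF assms]
  have "?L = ?L \<parallel> ((vassoc A (y \<bullet> x) w v \<parallel> vassoc A y x (w \<bullet> v))
       \<parallel> (vassoc_inv A y x (w \<bullet> v) \<parallel> vassoc_inv A (y \<bullet> x) w v))"
    using assms by (simp add: glob_assoc)
  also have "\<dots> = ?R"
    unfolding pent[symmetric] using assms by (simp add: glob_assoc hpaste_tail[OF pp(2)])
  finally show "?L = ?R" .
  have "?L' = vassoc_inv A (y \<bullet> x) w v \<parallel> ((?p \<parallel> (vassoc A y (x \<bullet> w) v \<parallel> ?q)) \<parallel> (?q' \<parallel> vassoc_inv A
      y (x \<bullet> w) v))"
    using assms by (simp add: glob_assoc hpaste_tail[OF qq(1)])
  also have "\<dots> = ?R'"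
    unfolding pent using assms by (simp add: glob_assoc)
  finally show "?L' = ?R'" .
qed

lemma vassoc_idem_hidc:
  assumes "v \<in> Ver A" "w \<in> Ver A" "x \<in> Ver A" "vcod A v = vdom A w" "vcod A w = vdom A x"
    and "vassoc A x w v = vassoc A x w v \<parallel> vassoc A x w v"
    and "(x \<bullet> w) \<bullet> v = x \<bullet> (w \<bullet> v)"
  shows "vassoc A x w v = hidc A (x \<bullet> (w \<bullet> v))" 
proof -
  have "vassoc A x w v = vassoc_inv A x w v \<parallel> (vassoc A x w v \<parallel> vassoc A x w v)"
    using assms(1-5,7) by simp
  also have "\<dots> = vassoc_inv A x w v \<parallel> vassoc A x w v" using assms(6) by simp
  also have "\<dots> = hidc A (x \<bullet> (w \<bullet> v))" using assms(1-5) by simp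
  finally show ?thesis .
qed

text \<open>
The argument is Kelly's.  For an identity in one of the outer positions, the pentagon with two
adjacent identities there has all its unit associators of middle type trivial, and what is left says
that the associator equals its own square; being invertible, it is an identity.
\<close>

lemma vassoc_unit [simp]:
  assumes "v \<in> Ver A" "w \<in> Ver A" "vcod A v = vdom A w"
  shows "vdom A v = a \<Longrightarrow> vassoc A w v (vid A a) = hidc A (w \<bullet> v)"
    and "vcod A v = b \<Longrightarrow> vassoc A w (vid A b) v = hidc A (w \<bullet> v)"
    and "vcod A w = c \<Longrightarrow> vassoc A (vid A c) w v = hidc A (w \<bullet> v)"
proof -
  have mid: "vassoc A w (vid A (vcod A v)) v = hidc A (w \<bullet> v)" if "v \<in> Ver A" "w \<in> Ver A" "vcod A
      v = vdom A w"
    for v w using that vassoc_vid[of v _ _ w] by (auto simp: varr_def)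
  have mid': "vassoc A w (vid A a) (vid A a) = hidc A w" if "w \<in> Ver A" "vdom A w = a" for w a
    using mid[of "vid A a" w] that by auto
  have mid'': "vassoc A (vid A a) (vid A a) w = hidc A w" if "w \<in> Ver A" "vcod A w = a" for w a
    using mid[of w "vid A a"] that by auto
  show "vcod A v = b \<Longrightarrow> vassoc A w (vid A b) v = hidc A (w \<bullet> v)"
    using mid assms by auto
  show "vassoc A w v (vid A a) = hidc A (w \<bullet> v)" if "vdom A v = a"
  proof -
    have a: "a \<in> Obj A" using that assms by auto
    show ?thesis
      using vassoc_idem_hidc[of "vid A a" v w] pentagon_whisk[of "vid A a" "vid A a" v w] assms
          that a
      by (simp add: mid')
  qed
  show "vassoc A (vid A c) w v = hidc A (w \<bullet> v)" if "vcod A w = c"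
  proof -
    have c: "c \<in> Obj A" using that assms by auto
    show ?thesis
      using vassoc_idem_hidc[of v w "vid A c"] pentagon_whisk[of v w "vid A c" "vid A c"] assms
          that c
      by (simp add: mid'')
  qed
qed

lemma vassoc_inv_unit [simp]:
  assumes "v \<in> Ver A" "w \<in> Ver A" "vcod A v = vdom A w"
  shows "vdom A v = a \<Longrightarrow> vassoc_inv A w v (vid A a) = hidc A (w \<bullet> v)"
    and "vcod A v = b \<Longrightarrow> vassoc_inv A w (vid A b) v = hidc A (w \<bullet> v)"
    and "vcod A w = c \<Longrightarrow> vassoc_inv A (vid A c) w v = hidc A (w \<bullet> v)"
proof -
  have o: "vdom A v \<in> Obj A" "vcod A v \<in> Obj A" "vcod A w \<in> Obj A" using assms by auto
  show "vdom A v = a \<Longrightarrow> vassoc_inv A w v (vid A a) = hidc A (w \<bullet> v)"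
    using vassoc_simps(5-7)[of "vid A a" v w] vassoc_simps(2)[of "vid A a" v w] assms o by auto
  show "vcod A v = b \<Longrightarrow> vassoc_inv A w (vid A b) v = hidc A (w \<bullet> v)"
    using vassoc_simps(5-7)[of v "vid A b" w] vassoc_simps(2)[of v "vid A b" w] assms o by auto
  show "vcod A w = c \<Longrightarrow> vassoc_inv A (vid A c) w v = hidc A (w \<bullet> v)"
    using vassoc_simps(5-7)[of v w "vid A c"] vassoc_simps(2)[of v w "vid A c"] assms o by auto
qed

section \<open>Components of squares of vertical arrows\<close>

text \<open>
\<open>a\<close>, \<open>b\<close>, \<open>c\<close>, \<open>d\<close> are the upper left, upper right, lower left and lower right corners.  All four
sides are vertical arrows of \<open>A\<close>; for retrocells, \<open>f\<close> and \<open>g\<close> will be companions.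
\<close>

definition square :: "'c \<Rightarrow> 'v \<Rightarrow> 'v \<Rightarrow> 'v \<Rightarrow> 'v \<Rightarrow> 'o \<Rightarrow> 'o \<Rightarrow> 'o \<Rightarrow> 'o \<Rightarrow> bool" where
  "square \<alpha> f v w g a b c d \<longleftrightarrow>
     varr A f a b \<and> varr A v a c \<and> varr A w b d \<and> varr A g c d \<and> globular A \<alpha> (w \<bullet> f) (g \<bullet> v)"

text \<open>
The associators move \<open>y\<close> inside, so that \<open>component f v w g \<alpha> y\<close> goes from \<open>w \<bullet> (f \<bullet> y)\<close> to
\<open>g \<bullet> (v \<bullet> y)\<close>.
\<close>

definition component :: "'v \<Rightarrow> 'v \<Rightarrow> 'v \<Rightarrow> 'v \<Rightarrow> 'c \<Rightarrow> 'v \<Rightarrow> 'c" where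
  "component f v w g \<alpha> y = vassoc_inv A w f y \<parallel> ((\<alpha> \<triangleleft> y) \<parallel> vassoc A g v y)"

lemmas square_unfold = square_def varr_def globular_iff

text \<open>
Rewrite rules that push an inverse associator to the right until it meets the associator at the end
of a component and cancels.  Each rule comes in two forms, for the end and for the inside of a chain.
\<close>

lemmas slide_inv = vassoc_inv_whisk[OF _ _ refl] pentagon_split
  vassoc_inv_whisk[OF _ _ refl, THEN hpaste_tail] pentagon_split[THEN hpaste_tail]

lemma component_simps:
  assumes "square \<alpha> f v w g a b c d" "y \<in> Ver A" "vcod A y = a"
  shows "glob (component f v w g \<alpha> y)" "clft A (component f v w g \<alpha> y) = w \<bullet> (f \<bullet> y)"
    "crgt A (component f v w g \<alpha> y) = g \<bullet> (v \<bullet> y)"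
  using assms by (simp_all add: square_unfold component_def)

lemma component_vid:
  assumes "square \<alpha> f v w g a b c d"
  shows "component f v w g \<alpha> (vid A a) = \<alpha>"
  using assms by (simp add: square_unfold component_def)

text \<open>
Faithfulness of the representation: the identity is among the admissible arguments \<open>y\<close>, and the
component there is the square itself.
\<close>

lemma square_eqI:
  assumes "square \<alpha> f v w g a b c d" "square \<beta> f v w g a b c d"
    and "\<And>y. y \<in> Ver A \<Longrightarrow> vcod A y = a \<Longrightarrow> component f v w g \<alpha> y = component f v w g \<beta> y"
  shows "\<alpha> = \<beta>"
proof -
  have "a \<in> Obj A" using assms(1) by (auto simp: square_unfold)
  from assms(3)[of "vid A a"] this show ?thesis
    using assms by (simp add: component_vid)
qed

lemma component_natural:
  assumes "square \<alpha> f v w g a b c d" "globular A \<xi> y y'" "y \<in> Ver A" "vcod A y = a"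
  shows "(w \<triangleright> (f \<triangleright> \<xi>)) \<parallel> component f v w g \<alpha> y' = component f v w g \<alpha> y \<parallel> (g \<triangleright> (v \<triangleright> \<xi>))"
proof -
  note [simp] = assms[unfolded square_unfold]
  have [simp]: "y' \<in> Ver A" "vdom A y' = vdom A y" "vcod A y' = a"
    using glob_sides[of \<xi>] by simp_all
  have ex: "((w \<bullet> f) \<triangleright> \<xi>) \<parallel> (\<alpha> \<triangleleft> y') = (\<alpha> \<triangleleft> y) \<parallel> ((g \<bullet> v) \<triangleright> \<xi>)"
    using whisk_exchange[of \<alpha> \<xi>] by simp
  have "(w \<triangleright> (f \<triangleright> \<xi>)) \<parallel> component f v w g \<alpha> y'
     = ((w \<triangleright> (f \<triangleright> \<xi>)) \<parallel> vassoc_inv A w f y') \<parallel> ((\<alpha> \<triangleleft> y') \<parallel> vassoc A g v y')"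
    by (simp add: component_def glob_assoc)
  also have "\<dots> = (vassoc_inv A w f y \<parallel> ((w \<bullet> f) \<triangleright> \<xi>)) \<parallel> ((\<alpha> \<triangleleft> y') \<parallel> vassoc A g v y')"
    by (simp add: vassoc_inv_whisk(1)[of \<xi> y y'])
  also have "\<dots> = vassoc_inv A w f y \<parallel> ((\<alpha> \<triangleleft> y) \<parallel> (((g \<bullet> v) \<triangleright> \<xi>) \<parallel> vassoc A g v y'))"
    by (simp add: glob_assoc hpaste_tail[OF ex])
  also have "\<dots> = component f v w g \<alpha> y \<parallel> (g \<triangleright> (v \<triangleright> \<xi>))"
    by (simp add: component_def glob_assoc vassoc_whisk(1)[of \<xi> y y'])
  finally show ?thesis .
qed

text \<open>
The argument of \<open>component\<close> on the left is a horizontal composite of squares, with arbitrary globular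
cells \<open>\<sigma>\<close> and \<open>\<mu>\<close> attached at the top and at the bottom in place of the comparison cells.  The
leading inverse associator is pushed through the seven factors; each internal associator is absorbed
by the pentagon on the way.
\<close>

lemma component_hcomp:
  assumes "square \<alpha> f v w g a b c d" "square \<beta> h w x k b e d e'"
    and "globular A \<sigma> p (h \<bullet> f)" "globular A \<mu> (k \<bullet> g) q" "varr A p a e" "varr A q c e'" "y \<in> Ver
        A" "vcod A y = a"
  shows "component p v x q
      ((x \<triangleright> \<sigma>) \<parallel> vassoc_inv A x h f \<parallel> (\<beta> \<triangleleft> f) \<parallel> vassoc A k w f \<parallel> (k \<triangleright> \<alpha>) \<parallel> vassoc_inv A k g v \<parallel> (\<mu>
          \<triangleleft> v)) y
    = (x \<triangleright> ((\<sigma> \<triangleleft> y) \<parallel> vassoc A h f y)) \<parallel> (component h w x k \<beta> (f \<bullet> y) \<parallel>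
      ((k \<triangleright> component f v w g \<alpha> y) \<parallel> (vassoc_inv A k g (v \<bullet> y) \<parallel> (\<mu> \<triangleleft> (v \<bullet> y)))))"
proof -
  note [simp] = assms[unfolded square_unfold]
  show ?thesis
    by (simp add: component_def glob_assoc whisk_left_hpaste whisk_right_hpaste slide_inv)
qed

lemma component_vcomp:
  assumes "square \<alpha> f v w g a b c d" "square \<alpha>' g v' w' h c d e e'" "y \<in> Ver A" "vcod A y = a"
  shows "component f (v' \<bullet> v) (w' \<bullet> w) h
      (vassoc A w' w f \<parallel> (w' \<triangleright> \<alpha>) \<parallel> vassoc_inv A w' g v \<parallel> (\<alpha>' \<triangleleft> v) \<parallel> vassoc A h v' v) y
    = vassoc A w' w (f \<bullet> y) \<parallel> ((w' \<triangleright> component f v w g \<alpha> y) \<parallel>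
      (component g v' w' h \<alpha>' (v \<bullet> y) \<parallel> (h \<triangleright> vassoc_inv A v' v y)))"
proof -
  note [simp] = assms[unfolded square_unfold]
  show ?thesis
    by (simp add: component_def glob_assoc whisk_left_hpaste whisk_right_hpaste slide_inv)
qed

text \<open>
Globular cells are squares with identities at the top and the bottom, and then the component is mere
whiskering.
\<close>

lemma component_globular:
  assumes "varr A v a c" "varr A w a c" "globular A \<alpha> w v" "y \<in> Ver A" "vcod A y = a"
  shows "component (vid A a) v w (vid A c) \<alpha> y = \<alpha> \<triangleleft> y"
proof -
  note [simp] = assms[unfolded varr_def globular_iff] varr_obj[OF assms(1)]
  show ?thesis by (simp add: component_def)
qed

section \<open>Companions in a double category\<close>

text \<open>
Vertical pasting is strictly associative when the associators at the two sides are trivial.  The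
binding cells of companions have enough identity sides for this to apply to the stacks of them that
make up a companion of a composite.
\<close>

lemma vpaste_assoc_unit:
  assumes c: "cell A \<alpha> f v w g" "cell A \<beta> g v' w' h" "cell A \<gamma> h v'' w'' k"
    and "vassoc A v'' v' v = hidc A (v'' \<bullet> (v' \<bullet> v))" "vassoc A w'' w' w = hidc A ((w'' \<bullet> w') \<bullet>
        w)"
  shows "(\<alpha> \<sslash> \<beta>) \<sslash> \<gamma> = \<alpha> \<sslash> (\<beta> \<sslash> \<gamma>)"
  using vassoc_natural[OF c] assms(4,5)
    hidc_hpaste[OF vpaste_cell[OF vpaste_cell[OF c(1,2)] c(3)]]
    hpaste_hidc[OF vpaste_cell[OF c(1) vpaste_cell[OF c(2,3)]]]
  by simp

lemma companionD:
  assumes "companion A f p \<psi> \<chi>" "harr A f a b"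
  shows "varr A p a b" "cell A \<psi> (hid A a) (vid A a) p f" "cell A \<chi> f p (vid A b) (hid A b)"
    "\<psi> \<parallel> \<chi> = vidc A f" "\<psi> \<sslash> \<chi> = hidc A p"
  using assms by (auto simp: companion_def harr_def)

lemma harr_obj: "harr A f a b \<Longrightarrow> a \<in> Obj A" "harr A f a b \<Longrightarrow> b \<in> Obj A"
  using hdom_obj hcod_obj by (auto simp: harr_def)

lemma cell_hidc_vid: "a \<in> Obj A \<Longrightarrow> cell A (hidc A (vid A a)) (hid A a) (vid A a) (vid A a) (hid A
    a)"
  using hidc_cell vid_arr by blast

lemma vid_vpaste:
  assumes "cell A \<alpha> (hid A a) v w g" "a \<in> Obj A" shows "hidc A (vid A a) \<sslash> \<alpha> = \<alpha>"
  using vidc_vpaste[OF assms(1)] vidc_hid[OF assms(2)] by simp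

lemma vpaste_vid:
  assumes "cell A \<alpha> f v w (hid A c)" "c \<in> Obj A" shows "\<alpha> \<sslash> hidc A (vid A c) = \<alpha>"
  using vpaste_vidc[OF assms(1)] vidc_hid[OF assms(2)] by simp

lemma globular_cell:
  assumes "varr A p a b"
  shows "globular A \<theta> p q \<longleftrightarrow> cell A \<theta> (hid A a) p q (hid A b)"
  using assms by (auto simp: globular_def varr_def)

text \<open>
The universal properties of a companion.  Pasting with \<open>\<psi>\<close> on the left and pasting \<open>\<chi>\<close> below are
inverse bijections between globular cells \<open>p \<Rightarrow> q\<close> and cells with left side an identity, right side
\<open>q\<close>, top an identity and bottom \<open>f\<close>; the third statement is half of the dual bijection.
\<close>

lemma companion_yoneda:
  assumes comp: "companion A f p \<psi> \<chi>" and f: "harr A f a b"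
  shows "globular A \<theta> p q \<Longrightarrow> (\<psi> \<parallel> \<theta>) \<sslash> \<chi> = \<theta>"
    and "cell A \<xi> (hid A a) (vid A a) q f \<Longrightarrow> \<psi> \<parallel> (\<xi> \<sslash> \<chi>) = \<xi>"
    and "cell A \<zeta> f q (vid A b) (hid A b) \<Longrightarrow> (\<psi> \<sslash> \<zeta>) \<parallel> \<chi> = \<zeta>"
proof -
  note c = companionD[OF comp f]
  note a = harr_obj(1)[OF f] and b = harr_obj(2)[OF f]
  show "(\<psi> \<parallel> \<theta>) \<sslash> \<chi> = \<theta>" if "globular A \<theta> p q"
  proof -
    have t: "cell A \<theta> (hid A a) p q (hid A b)" using that globular_cell[OF c(1)] by simp
    have "(\<psi> \<parallel> \<theta>) \<sslash> (\<chi> \<parallel> hidc A (vid A b)) = (\<psi> \<sslash> \<chi>) \<parallel> (\<theta> \<sslash> hidc A (vid A b))"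
      by (rule interchange[OF c(2) t c(3) cell_hidc_vid[OF b]])
    then show ?thesis
      using hpaste_hidc[OF c(3)] vpaste_vid[OF t b] hidc_hpaste[OF t] c(5) by simp
  qed
  show "\<psi> \<parallel> (\<xi> \<sslash> \<chi>) = \<xi>" if x: "cell A \<xi> (hid A a) (vid A a) q f"
  proof -
    have "(hidc A (vid A a) \<parallel> \<xi>) \<sslash> (\<psi> \<parallel> \<chi>) = (hidc A (vid A a) \<sslash> \<psi>) \<parallel> (\<xi> \<sslash> \<chi>)"
      by (rule interchange[OF cell_hidc_vid[OF a] x c(2,3)])
    then show ?thesis
      using hidc_hpaste[OF x] vid_vpaste[OF c(2) a] vpaste_vidc[OF x] c(4) by simp
  qed
  show "(\<psi> \<sslash> \<zeta>) \<parallel> \<chi> = \<zeta>" if z: "cell A \<zeta> f q (vid A b) (hid A b)"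
  proof -
    have "(\<psi> \<parallel> \<chi>) \<sslash> (\<zeta> \<parallel> hidc A (vid A b)) = (\<psi> \<sslash> \<zeta>) \<parallel> (\<chi> \<sslash> hidc A (vid A b))"
      by (rule interchange[OF c(2,3) z cell_hidc_vid[OF b]])
    then show ?thesis
      using hpaste_hidc[OF z] vpaste_vid[OF c(3) b] vidc_vpaste[OF z] c(4) by simp
  qed
qed

lemma companion_eqI:
  assumes "companion A f p \<psi> \<chi>" "harr A f a b" "globular A \<theta> p q" "globular A \<theta>' p q"
    and "\<psi> \<parallel> \<theta> = \<psi> \<parallel> \<theta>'"
  shows "\<theta> = \<theta>'"
  using companion_yoneda(1)[OF assms(1,2)] assms(3-5) by metis

text \<open>
Companions of the same arrow are canonically isomorphic: the paste of one \<open>\<psi>\<close> with the other \<open>\<chi>\<close> is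
the only globular cell compatible with both \<open>\<psi>\<close>, so the comparisons in the two directions compose to
the identity.
\<close>

lemma companion_comparison:
  assumes comp: "companion A f p \<psi> \<chi>" and comp': "companion A f p' \<psi>' \<chi>'" and f: "harr A f a b"
  shows "globular A (\<psi>' \<sslash> \<chi>) p p'" "\<psi> \<parallel> (\<psi>' \<sslash> \<chi>) = \<psi>'"
    "(\<psi>' \<sslash> \<chi>) \<parallel> (\<psi> \<sslash> \<chi>') = hidc A p"
proof -
  have *: "globular A (\<psi>' \<sslash> \<chi>) p p'" "\<psi> \<parallel> (\<psi>' \<sslash> \<chi>) = \<psi>'"
    if comp: "companion A f p \<psi> \<chi>" and comp': "companion A f p' \<psi>' \<chi>'" for p \<psi> \<chi> p' \<psi>' \<chi>'
  proof -
    note c = companionD[OF comp f] and c' = companionD[OF comp' f]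
    show "globular A (\<psi>' \<sslash> \<chi>) p p'"
      using vpaste_cell[OF c'(2) c(3)] globular_cell[OF c(1)] vcomp_vid[OF c(1)] vid_vcomp[OF
          c'(1)]
      by simp
    show "\<psi> \<parallel> (\<psi>' \<sslash> \<chi>) = \<psi>'"
      by (rule companion_yoneda(2)[OF comp f c'(2)])
  qed
  show g: "globular A (\<psi>' \<sslash> \<chi>) p p'" "\<psi> \<parallel> (\<psi>' \<sslash> \<chi>) = \<psi>'"
    using *[OF comp comp'] .
  note g' = *[OF comp' comp]
  note c = companionD[OF comp f] and c' = companionD[OF comp' f]
  note cells = g(1)[unfolded globular_cell[OF c(1)]] g'(1)[unfolded globular_cell[OF c'(1)]]
  show "(\<psi>' \<sslash> \<chi>) \<parallel> (\<psi> \<sslash> \<chi>') = hidc A p"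
  proof (rule companion_eqI[OF comp f])
    show "globular A ((\<psi>' \<sslash> \<chi>) \<parallel> (\<psi> \<sslash> \<chi>')) p p" "globular A (hidc A p) p p"
      using g(1) g'(1) c(1) by (auto simp: globular_iff varr_def)
    show "\<psi> \<parallel> ((\<psi>' \<sslash> \<chi>) \<parallel> (\<psi> \<sslash> \<chi>')) = \<psi> \<parallel> hidc A p"
      using hpaste_assoc[OF c(2) cells] g(2) g'(2) hpaste_hidc[OF c(2)] by simp
  qed
qed

text \<open>
The first companion identity is an interchange.  For the second, the four rows
\<open>\<psi>\<close>, \<open>id\<^sub>f \<parallel> \<psi>'\<close>, \<open>\<chi> \<parallel> id\<^sub>h\<close>, \<open>\<chi>'\<close> are regrouped so that the middle two become \<open>\<chi> \<parallel> \<psi>'\<close>; in the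
resulting diagram \<open>\<psi>\<close> lies above \<open>\<chi>\<close> in the left column and \<open>\<psi>'\<close> above \<open>\<chi>'\<close> in the right one.
\<close>

lemma companion_hcomp:
  assumes comp: "companion A f p \<psi> \<chi>" and comp': "companion A h p' \<psi>' \<chi>'"
    and f: "harr A f a b" and h: "harr A h b c"
  shows "companion A (h \<odot> f) (p' \<bullet> p) (\<psi> \<sslash> (vidc A f \<parallel> \<psi>')) ((\<chi> \<parallel> vidc A h) \<sslash> \<chi>')"
proof -
  note c = companionD[OF comp f] and c' = companionD[OF comp' h]
  note [simp] = harr_obj[OF f] harr_obj[OF h]
  note [simp] = c(1)[unfolded varr_def] c'(1)[unfolded varr_def]
  note id_f = vidc_cell[OF f] and id_h = vidc_cell[OF h]
  let ?E = "vidc A f \<parallel> \<psi>'" and ?F = "\<chi> \<parallel> vidc A h"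
  have hf: "h \<odot> f \<in> Hor A" "hdom A (h \<odot> f) = a" "hcod A (h \<odot> f) = c"
    using hcomp_arr[OF f h] by (auto simp: harr_def)
  have E: "cell A ?E f (vid A a) p' (h \<odot> f)"
    using hpaste_cell[OF id_f c'(2)] hid_hcomp[OF f] by simp
  have F: "cell A ?F (h \<odot> f) p (vid A c) h"
    using hpaste_cell[OF c(3) id_h] hcomp_hid[OF h] by simp
  have Psi: "cell A (\<psi> \<sslash> ?E) (hid A a) (vid A a) (p' \<bullet> p) (h \<odot> f)"
    using vpaste_cell[OF c(2) E] by simp
  have Chi: "cell A (?F \<sslash> \<chi>') (h \<odot> f) (p' \<bullet> p) (vid A c) (hid A c)"
    using vpaste_cell[OF F c'(3)] by simp
  have "(\<psi> \<sslash> ?E) \<parallel> (?F \<sslash> \<chi>') = (\<psi> \<parallel> ?F) \<sslash> (?E \<parallel> \<chi>')"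
    using interchange[OF c(2) F E c'(3)] by simp
  also have "\<psi> \<parallel> ?F = vidc A (h \<odot> f)"
    using hpaste_assoc[OF c(2,3) id_h] c(4) vidc_hcomp[OF f h] by simp
  also have "?E \<parallel> \<chi>' = vidc A (h \<odot> f)"
    using hpaste_assoc[OF id_f c'(2,3)] c'(4) vidc_hcomp[OF f h] by simp
  also have "vidc A (h \<odot> f) \<sslash> vidc A (h \<odot> f) = vidc A (h \<odot> f)"
    using vidc_vpaste[OF vidc_cell[OF hcomp_arr[OF f h]]] .
  finally have bind1: "(\<psi> \<sslash> ?E) \<parallel> (?F \<sslash> \<chi>') = vidc A (h \<odot> f)" .
  have mid: "cell A (\<chi> \<parallel> \<psi>') f p p' h"
    using hpaste_cell[OF c(3) c'(2)] hid_hcomp[OF f] hcomp_hid[OF h] by simp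
  have row: "cell A (\<chi> \<sslash> hidc A p') f (p' \<bullet> p) p' (hid A c)"
    using vpaste_cell[OF c(3) hidc_cell[OF c'(1)]] by simp
  have "(\<psi> \<sslash> ?E) \<sslash> (?F \<sslash> \<chi>') = \<psi> \<sslash> (?E \<sslash> (?F \<sslash> \<chi>'))"
    by (rule vpaste_assoc_unit[OF c(2) E Chi]) simp_all
  also have "?E \<sslash> (?F \<sslash> \<chi>') = (?E \<sslash> ?F) \<sslash> \<chi>'"
    by (rule vpaste_assoc_unit[OF E F c'(3), symmetric]) simp_all
  also have "?E \<sslash> ?F = \<chi> \<parallel> \<psi>'"
    using interchange[OF id_f c'(2) c(3) id_h] vidc_vpaste[OF c(3)] vpaste_vidc[OF c'(2)] by simp
  also have "(\<chi> \<parallel> \<psi>') \<sslash> \<chi>' = (\<chi> \<sslash> hidc A p') \<parallel> hidc A p'"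
    using interchange[OF c(3) c'(2) hidc_cell[OF c'(1)] c'(3)] hidc_hpaste[OF c'(3)] c'(5) by simp
  \<comment> \<open>The identity cell on \<open>p\<close> completes the right column.\<close>
  also have "\<psi> \<sslash> \<dots> = (\<psi> \<parallel> hidc A p) \<sslash> ((\<chi> \<sslash> hidc A p') \<parallel> hidc A p')"
    using hpaste_hidc[OF c(2)] by simp
  also have "\<dots> = (\<psi> \<sslash> (\<chi> \<sslash> hidc A p')) \<parallel> (hidc A p \<sslash> hidc A p')"
    by (rule interchange[OF c(2) hidc_cell[OF c(1)] row hidc_cell[OF c'(1)]])
  also have "\<psi> \<sslash> (\<chi> \<sslash> hidc A p') = (\<psi> \<sslash> \<chi>) \<sslash> hidc A p'"
    by (rule vpaste_assoc_unit[OF c(2,3) hidc_cell[OF c'(1)], symmetric]) simp_all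
  also have "\<dots> = hidc A (p' \<bullet> p)"
    using c(5) by (simp add: hidc_vpaste_hidc)
  also have "hidc A (p' \<bullet> p) \<parallel> (hidc A p \<sslash> hidc A p') = hidc A (p' \<bullet> p)"
    by (simp add: hidc_vpaste_hidc)
  finally have bind2: "(\<psi> \<sslash> ?E) \<sslash> (?F \<sslash> \<chi>') = hidc A (p' \<bullet> p)" .
  show ?thesis
    unfolding companion_def hf
    using Psi Chi bind1 bind2 vcomp_arr[OF c(1) c'(1)] by blast
qed

end

section \<open>Comparison cells of chosen companions\<close>

locale companion_double_category = double_category A
  for A :: "('o, 'h, 'v, 'c) dblcat" (structure) +
  fixes K :: "('h, 'v, 'c) companions"
  assumes choice: "companion_choice A K"
begin

lemma cmp_companion:
  assumes "harr A f a b"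
  shows "companion A f (cmp K f) (psi K f) (chi K f)"
  using choice assms by (auto simp: companion_choice_def harr_def)

lemma cmp_hid [simp]:
  assumes "a \<in> Obj A"
  shows "cmp K (hid A a) = vid A a" "psi K (hid A a) = hidc A (vid A a)"
    "chi K (hid A a) = hidc A (vid A a)"
  using choice assms by (auto simp: companion_choice_def)

lemma cmp_varr:
  assumes "harr A f a b"
  shows "varr A (cmp K f) a b"
  by (rule companionD(1)[OF cmp_companion[OF assms] assms])

text \<open>
\<open>h\<^sub>* \<bullet> f\<^sub>*\<close> and \<open>(h f)\<^sub>*\<close> are both companions of \<open>h f\<close>, and the two cells are the comparisons between
them.
\<close>

lemma cmp_split_merge:
  assumes f: "harr A f a b" and h: "harr A h b c"
  shows "globular A (cmp_split A K h f) (cmp K (h \<odot> f)) (cmp K h \<bullet> cmp K f)"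
    and "globular A (cmp_merge A K h f) (cmp K h \<bullet> cmp K f) (cmp K (h \<odot> f))"
    and "cmp_split A K h f \<parallel> cmp_merge A K h f = hidc A (cmp K (h \<odot> f))"
    and "cmp_merge A K h f \<parallel> cmp_split A K h f = hidc A (cmp K h \<bullet> cmp K f)"
    and "psi K (h \<odot> f) \<parallel> cmp_split A K h f = psi K f \<sslash> (vidc A f \<parallel> psi K h)"
proof -
  note hf = hcomp_arr[OF f h]
  note comp = cmp_companion[OF hf]
  note comp' = companion_hcomp[OF cmp_companion[OF f] cmp_companion[OF h] f h]
  show "globular A (cmp_split A K h f) (cmp K (h \<odot> f)) (cmp K h \<bullet> cmp K f)"
    "globular A (cmp_merge A K h f) (cmp K h \<bullet> cmp K f) (cmp K (h \<odot> f))"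
    "cmp_split A K h f \<parallel> cmp_merge A K h f = hidc A (cmp K (h \<odot> f))"
    "cmp_merge A K h f \<parallel> cmp_split A K h f = hidc A (cmp K h \<bullet> cmp K f)"
    "psi K (h \<odot> f) \<parallel> cmp_split A K h f = psi K f \<sslash> (vidc A f \<parallel> psi K h)"
    unfolding cmp_split_def cmp_merge_def
    using companion_comparison[OF comp comp' hf] companion_comparison[OF comp' comp hf] by auto
qed

lemma cmp_split_unit:
  assumes f: "harr A f a b"
  shows "cmp_split A K f (hid A a) = hidc A (cmp K f)"
    and "cmp_split A K (hid A b) f = hidc A (cmp K f)"
proof -
  note [simp] = harr_obj[OF f]
  note c = companionD[OF cmp_companion[OF f] f]
  note a = hid_arr[of a] and b = hid_arr[of b]
  have id: "globular A (hidc A (cmp K f)) (cmp K f) (cmp K f)"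
    using globular_cell[OF c(1)] hidc_cell[OF c(1)] by simp
  show "cmp_split A K f (hid A a) = hidc A (cmp K f)"
  proof (rule companion_eqI[OF cmp_companion[OF f] f _ id])
    show "globular A (cmp_split A K f (hid A a)) (cmp K f) (cmp K f)"
      using cmp_split_merge(1)[OF a f] hcomp_hid[OF f] vcomp_vid[OF c(1)] by simp
    show "psi K f \<parallel> cmp_split A K f (hid A a) = psi K f \<parallel> hidc A (cmp K f)"
      using cmp_split_merge(5)[OF a f] hcomp_hid[OF f] hidc_hpaste[OF c(2)] vid_vpaste[OF c(2)]
        hpaste_hidc[OF c(2)] by (simp add: vidc_hid)
  qed
  show "cmp_split A K (hid A b) f = hidc A (cmp K f)"
  proof (rule companion_eqI[OF cmp_companion[OF f] f _ id])
    show "globular A (cmp_split A K (hid A b) f) (cmp K f) (cmp K f)"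
      using cmp_split_merge(1)[OF f b] hid_hcomp[OF f] vid_vcomp[OF c(1)] by simp
    show "psi K f \<parallel> cmp_split A K (hid A b) f = psi K f \<parallel> hidc A (cmp K f)"
      using cmp_split_merge(5)[OF f b] hid_hcomp[OF f] hpaste_hidc[OF vidc_cell[OF f]]
        vpaste_vidc[OF c(2)] hpaste_hidc[OF c(2)] by simp
  qed
qed

lemma cmp_merge_unit:
  assumes f: "harr A f a b"
  shows "cmp_merge A K f (hid A a) = hidc A (cmp K f)"
    and "cmp_merge A K (hid A b) f = hidc A (cmp K f)"
proof -
  note [simp] = harr_obj[OF f]
  note a = hid_arr[of a] and b = hid_arr[of b]
  note c = cmp_varr[OF f]
  show "cmp_merge A K f (hid A a) = hidc A (cmp K f)"
    using cmp_split_merge[OF a f] cmp_split_unit(1)[OF f] hcomp_hid[OF f] vcomp_vid[OF c]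
    by (simp add: globular_iff)
  show "cmp_merge A K (hid A b) f = hidc A (cmp K f)"
    using cmp_split_merge[OF f b] cmp_split_unit(2)[OF f] hid_hcomp[OF f] vid_vcomp[OF c]
    by (simp add: globular_iff)
qed

text \<open>
The two ways of splitting \<open>(l h f)\<^sub>*\<close> into three companions agree up to the associator.  Both sides
are determined by their paste with \<open>\<psi>\<close>, and both pastes are the staircase of the three binding cells
\<open>\<psi>\<^sub>f\<close>, \<open>\<psi>\<^sub>h\<close>, \<open>\<psi>\<^sub>l\<close>.
\<close>

lemma cmp_split_assoc:
  assumes f: "harr A f a b" and h: "harr A h b c" and l: "harr A l c d"
  shows "cmp_split A K l (h \<odot> f) \<parallel> (cmp K l \<triangleright> cmp_split A K h f)
    = cmp_split A K (l \<odot> h) f \<parallel> ((cmp_split A K l h \<triangleleft> cmp K f) \<parallel> vassoc A (cmp K l) (cmp K h) (cmp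
        K f))"
    (is "?L = ?R")
proof -
  note hf = hcomp_arr[OF f h] and lh = hcomp_arr[OF h l] and assoc = hcomp_assoc[OF f h l]
  note lhf = hcomp_arr[OF hf l]
  note cf = companionD[OF cmp_companion[OF f] f] and ch = companionD[OF cmp_companion[OF h] h]
    and cl = companionD[OF cmp_companion[OF l] l] and chf = companionD[OF cmp_companion[OF hf] hf]
    and clh = companionD[OF cmp_companion[OF lh] lh] and clhf = companionD[OF cmp_companion[OF
        lhf] lhf]
  note [simp] = cf(1)[unfolded varr_def] ch(1)[unfolded varr_def] cl(1)[unfolded varr_def]
    chf(1)[unfolded varr_def] clh(1)[unfolded varr_def] clhf(1)[unfolded varr_def]
  note s1 = cmp_split_merge(1,5)[OF hf l] and s2 = cmp_split_merge(1,5)[OF f h]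
    and s3 = cmp_split_merge(1,5)[OF f lh, unfolded assoc] and s4 = cmp_split_merge(1,5)[OF h l]
  note [simp] = s1(1)[unfolded globular_iff] s2(1)[unfolded globular_iff]
    s3(1)[unfolded globular_iff] s4(1)[unfolded globular_iff] harr_obj[OF f] harr_obj[OF l]
  note id_f = vidc_cell[OF f] and id_h = vidc_cell[OF h] and id_hf = vidc_cell[OF hf]
  \<comment> \<open>\<open>?P\<close> is the common value of the two pastes with \<open>\<psi>\<close>.\<close>
  let ?P = "(psi K f \<sslash> (vidc A f \<parallel> psi K h)) \<sslash> (vidc A (h \<odot> f) \<parallel> psi K l)"
  have globL: "globular A ?L (cmp K (l \<odot> (h \<odot> f))) (cmp K l \<bullet> (cmp K h \<bullet> cmp K f))"
    and globR: "globular A ?R (cmp K (l \<odot> (h \<odot> f))) (cmp K l \<bullet> (cmp K h \<bullet> cmp K f))"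
    by (simp_all add: globular_iff)
  have cell_glob: "cell A \<theta> (hid A x) p q (hid A y)" if "varr A p x y" "glob \<theta>" "clft A \<theta> = p"
      "crgt A \<theta> = q"
    for \<theta> p q x y
    using that by (auto simp: globular_cell[OF that(1), symmetric] globular_iff)
  have S_hf: "cell A (cmp_split A K h f) (hid A a) (cmp K (h \<odot> f)) (cmp K h \<bullet> cmp K f) (hid A c)"
    and S_lh: "cell A (cmp_split A K l h) (hid A b) (cmp K (l \<odot> h)) (cmp K l \<bullet> cmp K h) (hid A d)"
    by (simp_all add: cell_glob varr_def)
  have E: "cell A (vidc A f \<parallel> psi K h) f (vid A a) (cmp K h) (h \<odot> f)"
    using hpaste_cell[OF id_f ch(2)] hid_hcomp[OF f] by simp
  have E': "cell A (vidc A (h \<odot> f) \<parallel> psi K l) (h \<odot> f) (vid A a) (cmp K l) (l \<odot> (h \<odot> f))"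
    using hpaste_cell[OF id_hf cl(2)] hid_hcomp[OF hf] by simp
  have D: "cell A (vidc A f \<parallel> psi K (l \<odot> h)) f (vid A a) (cmp K (l \<odot> h)) (l \<odot> (h \<odot> f))"
    using hpaste_cell[OF id_f clh(2)] hid_hcomp[OF f] assoc by simp
  have D': "cell A (vidc A h \<parallel> psi K l) h (vid A b) (cmp K l) (l \<odot> h)"
    using hpaste_cell[OF id_h cl(2)] hid_hcomp[OF h] by simp
  have "psi K (l \<odot> (h \<odot> f)) \<parallel> ?L
      = (psi K (h \<odot> f) \<sslash> (vidc A (h \<odot> f) \<parallel> psi K l)) \<parallel> (cmp_split A K h f \<sslash> hidc A (cmp K l))"
  proof -
    have L1: "cell A (cmp_split A K l (h \<odot> f)) (hid A a) (cmp K (l \<odot> (h \<odot> f)))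
        (cmp K l \<bullet> cmp K (h \<odot> f)) (hid A d)"
      and L2: "cell A (cmp K l \<triangleright> cmp_split A K h f) (hid A a) (cmp K l \<bullet> cmp K (h \<odot> f))
        (cmp K l \<bullet> (cmp K h \<bullet> cmp K f)) (hid A d)"
      by (simp_all add: cell_glob varr_def)
    show ?thesis
      using hpaste_assoc[OF clhf(2) L1 L2] s1(2) by (simp add: whisk_left_def)
  qed
  also have "\<dots> = (psi K (h \<odot> f) \<parallel> cmp_split A K h f) \<sslash> ((vidc A (h \<odot> f) \<parallel> psi K l) \<parallel> hidc A (cmp K
      l))"
    by (rule interchange[OF chf(2) S_hf E' hidc_cell[OF cl(1)], symmetric])
  also have "\<dots> = ?P"
    using s2(2) hpaste_hidc[OF E'] by simp
  finally have 1: "psi K (l \<odot> (h \<odot> f)) \<parallel> ?L = ?P" .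
  let ?a = "vassoc A (cmp K l) (cmp K h) (cmp K f)"
  have "psi K (l \<odot> (h \<odot> f)) \<parallel> ?R
      = ((psi K (l \<odot> (h \<odot> f)) \<parallel> cmp_split A K (l \<odot> h) f) \<parallel> (cmp_split A K l h \<triangleleft> cmp K f)) \<parallel> ?a"
  proof -
    have R1: "cell A (cmp_split A K (l \<odot> h) f) (hid A a) (cmp K (l \<odot> (h \<odot> f)))
        (cmp K (l \<odot> h) \<bullet> cmp K f) (hid A d)"
      and R2: "cell A (cmp_split A K l h \<triangleleft> cmp K f) (hid A a) (cmp K (l \<odot> h) \<bullet> cmp K f)
        ((cmp K l \<bullet> cmp K h) \<bullet> cmp K f) (hid A d)"
      and R3: "cell A ?a (hid A a) ((cmp K l \<bullet> cmp K h) \<bullet> cmp K f) (cmp K l \<bullet> (cmp K h \<bullet> cmp K f))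
          (hid A d)"
      by (simp_all add: cell_glob varr_def)
    show ?thesis
      using hpaste_assoc[OF clhf(2) R1 hpaste_cell[OF R2 R3]]
        hpaste_assoc[OF hpaste_cell[OF clhf(2) R1] R2 R3] by simp
  qed
  also have "\<dots> = ((psi K f \<sslash> (vidc A f \<parallel> psi K (l \<odot> h))) \<parallel> (hidc A (cmp K f) \<sslash> cmp_split A K l h))
      \<parallel> ?a"
    using s3(2) by (simp add: whisk_right_def)
  also have "(psi K f \<sslash> (vidc A f \<parallel> psi K (l \<odot> h))) \<parallel> (hidc A (cmp K f) \<sslash> cmp_split A K l h)
      = (psi K f \<parallel> hidc A (cmp K f)) \<sslash> ((vidc A f \<parallel> psi K (l \<odot> h)) \<parallel> cmp_split A K l h)"
    by (rule interchange[OF cf(2) hidc_cell[OF cf(1)] D S_lh, symmetric])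
  also have "(vidc A f \<parallel> psi K (l \<odot> h)) \<parallel> cmp_split A K l h = vidc A f \<parallel> (psi K h \<sslash> (vidc A h \<parallel>
      psi K l))"
    using hpaste_assoc[OF id_f clh(2) S_lh] s4(2) by simp
  also have "\<dots> = (vidc A f \<parallel> psi K h) \<sslash> (vidc A f \<parallel> (vidc A h \<parallel> psi K l))"
    using interchange[OF id_f ch(2) id_f D'] vidc_vpaste[OF id_f] by simp
  also have "vidc A f \<parallel> (vidc A h \<parallel> psi K l) = vidc A (h \<odot> f) \<parallel> psi K l"
    using hpaste_assoc[OF id_f id_h cl(2)] vidc_hcomp[OF f h] by simp
  also have "psi K f \<parallel> hidc A (cmp K f) = psi K f"
    by (rule hpaste_hidc[OF cf(2)])
  also have "(psi K f \<sslash> ((vidc A f \<parallel> psi K h) \<sslash> (vidc A (h \<odot> f) \<parallel> psi K l))) \<parallel> ?a = ?P"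
    using vassoc_natural[OF cf(2) E E'] hidc_hpaste[OF vpaste_cell[OF vpaste_cell[OF cf(2) E] E']]
        by simp
  finally have 2: "psi K (l \<odot> (h \<odot> f)) \<parallel> ?R = ?P" .
  show ?thesis
    by (rule companion_eqI[OF cmp_companion[OF lhf] lhf globL globR]) (simp add: 1 2)
qed

text \<open>
The component at \<open>y\<close> of the comparison cell, \<open>(h f)\<^sub>* \<bullet> y \<Rightarrow> h\<^sub>* \<bullet> (f\<^sub>* \<bullet> y)\<close>; its inverse is
\<open>merge_at\<close>.
\<close>

definition split_at :: "'h \<Rightarrow> 'h \<Rightarrow> 'v \<Rightarrow> 'c" where
  "split_at h f y = (cmp_split A K h f \<triangleleft> y) \<parallel> vassoc A (cmp K h) (cmp K f) y"

definition merge_at :: "'h \<Rightarrow> 'h \<Rightarrow> 'v \<Rightarrow> 'c" where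
  "merge_at h f y = vassoc_inv A (cmp K h) (cmp K f) y \<parallel> (cmp_merge A K h f \<triangleleft> y)"

lemma split_merge_at:
  assumes "harr A f a b" "harr A h b c" "y \<in> Ver A" "vcod A y = a"
  shows "glob (split_at h f y)" "clft A (split_at h f y) = cmp K (h \<odot> f) \<bullet> y"
    "crgt A (split_at h f y) = cmp K h \<bullet> (cmp K f \<bullet> y)"
    "glob (merge_at h f y)" "clft A (merge_at h f y) = cmp K h \<bullet> (cmp K f \<bullet> y)"
    "crgt A (merge_at h f y) = cmp K (h \<odot> f) \<bullet> y"
    "split_at h f y \<parallel> merge_at h f y = hidc A (cmp K (h \<odot> f) \<bullet> y)"
    "merge_at h f y \<parallel> split_at h f y = hidc A (cmp K h \<bullet> (cmp K f \<bullet> y))"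
proof -
  note [simp] = assms(3,4) cmp_varr[OF assms(1), unfolded varr_def] cmp_varr[OF assms(2), unfolded
      varr_def]
    cmp_varr[OF hcomp_arr[OF assms(1,2)], unfolded varr_def]
    cmp_split_merge[OF assms(1,2), unfolded globular_iff]
  have w: "(cmp_split A K h f \<triangleleft> y) \<parallel> (cmp_merge A K h f \<triangleleft> y) = hidc A (cmp K (h \<odot> f) \<bullet> y)"
    "(cmp_merge A K h f \<triangleleft> y) \<parallel> (cmp_split A K h f \<triangleleft> y) = hidc A ((cmp K h \<bullet> cmp K f) \<bullet> y)"
    by (simp_all flip: whisk_right_hpaste)
  show "glob (split_at h f y)" "clft A (split_at h f y) = cmp K (h \<odot> f) \<bullet> y"
    "crgt A (split_at h f y) = cmp K h \<bullet> (cmp K f \<bullet> y)"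
    "glob (merge_at h f y)" "clft A (merge_at h f y) = cmp K h \<bullet> (cmp K f \<bullet> y)"
    "crgt A (merge_at h f y) = cmp K (h \<odot> f) \<bullet> y"
    "split_at h f y \<parallel> merge_at h f y = hidc A (cmp K (h \<odot> f) \<bullet> y)"
    "merge_at h f y \<parallel> split_at h f y = hidc A (cmp K h \<bullet> (cmp K f \<bullet> y))"
    by (simp_all add: split_at_def merge_at_def glob_assoc w hpaste_tail[OF w(2)])
qed

lemma split_at_unit:
  assumes "harr A f a b" "y \<in> Ver A" "vcod A y = a"
  shows "split_at f (hid A a) y = hidc A (cmp K f \<bullet> y)" "split_at (hid A b) f y = hidc A (cmp K f
      \<bullet> y)"
    "merge_at f (hid A a) y = hidc A (cmp K f \<bullet> y)" "merge_at (hid A b) f y = hidc A (cmp K f \<bullet>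
        y)"
  using assms(2,3) cmp_varr[OF assms(1), unfolded varr_def] harr_obj[OF assms(1)]
  by (simp_all add: split_at_def merge_at_def cmp_split_unit[OF assms(1)] cmp_merge_unit[OF
      assms(1)])

lemma split_merge_natural:
  assumes "harr A f a b" "harr A h b c" "glob \<xi>" "clft A \<xi> = y" "crgt A \<xi> = y'" "vcod A y = a"
  shows "split_at h f y \<parallel> (cmp K h \<triangleright> (cmp K f \<triangleright> \<xi>)) = (cmp K (h \<odot> f) \<triangleright> \<xi>) \<parallel> split_at h f y'"
    and "merge_at h f y \<parallel> (cmp K (h \<odot> f) \<triangleright> \<xi>) = (cmp K h \<triangleright> (cmp K f \<triangleright> \<xi>)) \<parallel> merge_at h f y'"
proof -
  note [simp] = assms(3-6) cmp_varr[OF assms(1), unfolded varr_def] cmp_varr[OF assms(2), unfolded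
      varr_def]
    cmp_varr[OF hcomp_arr[OF assms(1,2)], unfolded varr_def]
    cmp_split_merge[OF assms(1,2), unfolded globular_iff]
  have [simp]: "y \<in> Ver A" "y' \<in> Ver A" "vcod A y' = a"
    using glob_sides[of \<xi>] by simp_all
  have ex: "(cmp_split A K h f \<triangleleft> y) \<parallel> ((cmp K h \<bullet> cmp K f) \<triangleright> \<xi>) = (cmp K (h \<odot> f) \<triangleright> \<xi>) \<parallel> (cmp_split
      A K h f \<triangleleft> y')"
    "(cmp_merge A K h f \<triangleleft> y) \<parallel> (cmp K (h \<odot> f) \<triangleright> \<xi>) = ((cmp K h \<bullet> cmp K f) \<triangleright> \<xi>) \<parallel> (cmp_merge A K h
        f \<triangleleft> y')"
    using whisk_exchange[of "cmp_split A K h f" \<xi>] whisk_exchange[of "cmp_merge A K h f" \<xi>] by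
        simp_all
  show "split_at h f y \<parallel> (cmp K h \<triangleright> (cmp K f \<triangleright> \<xi>)) = (cmp K (h \<odot> f) \<triangleright> \<xi>) \<parallel> split_at h f y'"
    by (simp add: split_at_def glob_assoc vassoc_whisk(1)[of \<xi> y y'] hpaste_tail[OF ex(1)])
  show "merge_at h f y \<parallel> (cmp K (h \<odot> f) \<triangleright> \<xi>) = (cmp K h \<triangleright> (cmp K f \<triangleright> \<xi>)) \<parallel> merge_at h f y'"
    by (simp add: merge_at_def glob_assoc ex(2) hpaste_tail[OF vassoc_inv_whisk(1)[of \<xi> y y']])
qed

lemma split_at_assoc:
  assumes f: "harr A f a b" and h: "harr A h b c" and l: "harr A l c d" and y: "y \<in> Ver A" "vcod A
      y = a"
  shows "split_at l (h \<odot> f) y \<parallel> (cmp K l \<triangleright> split_at h f y) = split_at (l \<odot> h) f y \<parallel> split_at l h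
      (cmp K f \<bullet> y)"
proof -
  note hf = hcomp_arr[OF f h] and lh = hcomp_arr[OF h l] and assoc = hcomp_assoc[OF f h l]
  note [simp] = y cmp_varr[OF f, unfolded varr_def] cmp_varr[OF h, unfolded varr_def]
    cmp_varr[OF l, unfolded varr_def] cmp_varr[OF hf, unfolded varr_def] cmp_varr[OF lh, unfolded
        varr_def]
    cmp_varr[OF hcomp_arr[OF hf l], unfolded varr_def]
  note [simp] = cmp_split_merge(1)[OF f h, unfolded globular_iff] cmp_split_merge(1)[OF h l,
      unfolded globular_iff]
    cmp_split_merge(1)[OF hf l, unfolded globular_iff] cmp_split_merge(1)[OF f lh, unfolded
        globular_iff assoc]
  let ?a = "vassoc A (cmp K l) (cmp K h) (cmp K f)"
  have "split_at l (h \<odot> f) y \<parallel> (cmp K l \<triangleright> split_at h f y)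
    = ((cmp_split A K l (h \<odot> f) \<parallel> (cmp K l \<triangleright> cmp_split A K h f)) \<triangleleft> y) \<parallel>
      (vassoc A (cmp K l) (cmp K h \<bullet> cmp K f) y \<parallel> (cmp K l \<triangleright> vassoc A (cmp K h) (cmp K f) y))"
    by (simp add: split_at_def glob_assoc whisk_left_hpaste whisk_right_hpaste
        hpaste_tail[OF vassoc_whisk(2)[OF _ _ refl]])
  also have "\<dots> = (cmp_split A K (l \<odot> h) f \<triangleleft> y) \<parallel> (((cmp_split A K l h \<triangleleft> cmp K f) \<triangleleft> y) \<parallel>
     ((?a \<triangleleft> y) \<parallel> (vassoc A (cmp K l) (cmp K h \<bullet> cmp K f) y \<parallel> (cmp K l \<triangleright> vassoc A (cmp K h) (cmp K
         f) y))))"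
    by (simp add: cmp_split_assoc[OF f h l] glob_assoc whisk_right_hpaste)
  also have "\<dots> = split_at (l \<odot> h) f y \<parallel> split_at l h (cmp K f \<bullet> y)"
    by (simp add: split_at_def glob_assoc pentagon_whisk hpaste_tail[OF vassoc_whisk(3)[OF _ _
        refl]])
  finally show ?thesis .
qed

text \<open>
Obtained from \<open>split_at_assoc\<close> by passing to inverses.
\<close>

lemma merge_at_assoc:
  assumes f: "harr A f a b" and h: "harr A h b c" and l: "harr A l c d" and y: "y \<in> Ver A" "vcod A
      y = a"
  shows "merge_at l h (cmp K f \<bullet> y) \<parallel> merge_at (l \<odot> h) f y = (cmp K l \<triangleright> merge_at h f y) \<parallel> merge_at
      l (h \<odot> f) y"
    (is "?M1 \<parallel> ?M2 = ?M3 \<parallel> ?M4")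
proof -
  note hf = hcomp_arr[OF f h] and lh = hcomp_arr[OF h l] and assoc = hcomp_assoc[OF f h l]
  note [simp] = y cmp_varr[OF f, unfolded varr_def] cmp_varr[OF h, unfolded varr_def]
    cmp_varr[OF l, unfolded varr_def] cmp_varr[OF hf, unfolded varr_def] cmp_varr[OF lh, unfolded
        varr_def]
    cmp_varr[OF hcomp_arr[OF hf l], unfolded varr_def]
  note [simp] = split_merge_at[OF f h y] split_merge_at[OF h l] split_merge_at[OF hf l y]
    split_merge_at[OF f lh y, unfolded assoc]
  have S: "split_at l (h \<odot> f) y \<parallel> (cmp K l \<triangleright> split_at h f y) = split_at (l \<odot> h) f y \<parallel> split_at l h
      (cmp K f \<bullet> y)"
    by (rule split_at_assoc[OF assms])
  have w: "?M3 \<parallel> (cmp K l \<triangleright> split_at h f y) = hidc A (cmp K l \<bullet> (cmp K h \<bullet> (cmp K f \<bullet> y)))"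
    by (simp flip: whisk_left_hpaste)
  \<comment> \<open>The inserted factor \<open>?M3 \<parallel> ?M4 \<parallel> (split \<parallel> split)\<close> is an identity; \<open>split_at_assoc\<close> rewrites its
    last part into the inverse of \<open>?M1 \<parallel> ?M2\<close>.\<close>
  have "?M1 \<parallel> ?M2 = (?M3 \<parallel> (?M4 \<parallel> (split_at l (h \<odot> f) y \<parallel> (cmp K l \<triangleright> split_at h f y)))) \<parallel> (?M1 \<parallel>
      ?M2)"
    by (simp add: w hpaste_tail[OF split_merge_at(8)[OF hf l y]])
  also have "\<dots> = ?M3 \<parallel> ?M4"
    unfolding S
    by (simp add: glob_assoc hpaste_tail[OF split_merge_at(7)[OF h l]]
        split_merge_at(7)[OF f lh y, unfolded assoc])
  finally show ?thesis .
qed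

section \<open>Components of retrocells and of their pastings\<close>

definition retro_square :: "'c \<Rightarrow> 'h \<Rightarrow> 'v \<Rightarrow> 'v \<Rightarrow> 'h \<Rightarrow> 'o \<Rightarrow> 'o \<Rightarrow> 'o \<Rightarrow> 'o \<Rightarrow> bool" where
  "retro_square \<alpha> f v w g a b c d \<longleftrightarrow>
     harr A f a b \<and> harr A g c d \<and> square \<alpha> (cmp K f) v w (cmp K g) a b c d"

abbreviation retro_component :: "'h \<Rightarrow> 'v \<Rightarrow> 'v \<Rightarrow> 'h \<Rightarrow> 'c \<Rightarrow> 'v \<Rightarrow> 'c" where
  "retro_component f v w g \<equiv> component (cmp K f) v w (cmp K g)"

lemma retro_square_iff:
  "retro_square \<alpha> f v w g a b c d \<longleftrightarrow> harr A f a b \<and> varr A v a c \<and> varr A w b d \<and> harr A g c d \<and>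
     globular A \<alpha> (w \<bullet> cmp K f) (cmp K g \<bullet> v)"
  using cmp_varr by (auto simp: retro_square_def square_def)

lemma retro_squareD:
  assumes "retro_square \<alpha> f v w g a b c d"
  shows "harr A f a b" "harr A g c d" "square \<alpha> (cmp K f) v w (cmp K g) a b c d"
  using assms by (auto simp: retro_square_def)

lemmas retro_square_unfold = retro_square_def square_unfold harr_def

text \<open>
Equality of retrocells is tested on components.  The unit laws, associativity, interchange and
naturality of the associator below are all proved in this way.
\<close>

lemma retro_square_eqI:
  assumes "retro_square \<alpha> f v w g a b c d" "retro_square \<beta> f v w g a b c d"
    and "\<And>y. y \<in> Ver A \<Longrightarrow> vcod A y = a \<Longrightarrow> retro_component f v w g \<alpha> y = retro_component f v w g \<beta> y"
  shows "\<alpha> = \<beta>"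
  using square_eqI[OF retro_squareD(3)[OF assms(1)] retro_squareD(3)[OF assms(2)] assms(3)] .

lemma Ret_simps [simp]:
  "Obj (Ret A K) = Obj A" "Hor (Ret A K) = Hor A" "Ver (Ret A K) = Ver A"
  "hdom (Ret A K) = hdom A" "hcod (Ret A K) = hcod A" "hid (Ret A K) = hid A" "hcomp (Ret A K) =
      hcomp A"
  "vdom (Ret A K) = vdom A" "vcod (Ret A K) = vcod A" "vid (Ret A K) = vid A" "vcomp (Ret A K) =
      vcomp A"
  "hidc (Ret A K) = retro_hidc A" "hpaste (Ret A K) = retro_hpaste A K"
  "vidc (Ret A K) = retro_vidc A K" "vpaste (Ret A K) = retro_vpaste A K"
  "vassoc (Ret A K) = retro_vassoc A"
  "harr (Ret A K) = harr A" "varr (Ret A K) = varr A"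
  by (auto simp: Ret_def harr_def varr_def fun_eq_iff)

lemma Ret_cell:
  "cell (Ret A K) \<rho> f v w g \<longleftrightarrow> (\<exists>\<alpha> a b c d. \<rho> = Retro f v w g \<alpha> \<and> retro_square \<alpha> f v w g a b c d)"
  unfolding cell_def Ret_def retrocells_def retro_square_iff by (auto; blast)

lemma Ret_cellE:
  assumes "cell (Ret A K) \<rho> f v w g"
  obtains \<alpha> a b c d where "\<rho> = Retro f v w g \<alpha>" "retro_square \<alpha> f v w g a b c d"
  using assms Ret_cell by auto

lemma retro_square_corners:
  assumes "retro_square \<alpha> f v w g a b c d"
  shows "a = vdom A v" "b = vdom A w" "c = vcod A v" "d = vcod A w"
    "a = hdom A f" "b = hcod A f" "c = hdom A g" "d = hcod A g"
  using assms by (auto simp: retro_square_unfold)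

definition retro_hcell :: "'h \<Rightarrow> 'v \<Rightarrow> 'v \<Rightarrow> 'h \<Rightarrow> 'c \<Rightarrow> 'h \<Rightarrow> 'v \<Rightarrow> 'h \<Rightarrow> 'c \<Rightarrow> 'c" where
  "retro_hcell f v w g \<alpha> h x k \<beta> = (x \<triangleright> cmp_split A K h f) \<parallel> vassoc_inv A x (cmp K h) (cmp K f)
     \<parallel> (\<beta> \<triangleleft> cmp K f) \<parallel> vassoc A (cmp K k) w (cmp K f) \<parallel> (cmp K k \<triangleright> \<alpha>)
     \<parallel> vassoc_inv A (cmp K k) (cmp K g) v \<parallel> (cmp_merge A K k g \<triangleleft> v)"

definition retro_vcell :: "'h \<Rightarrow> 'v \<Rightarrow> 'v \<Rightarrow> 'h \<Rightarrow> 'c \<Rightarrow> 'v \<Rightarrow> 'v \<Rightarrow> 'h \<Rightarrow> 'c \<Rightarrow> 'c" where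
  "retro_vcell f v w g \<alpha> v' w' h \<alpha>' = vassoc A w' w (cmp K f) \<parallel> (w' \<triangleright> \<alpha>)
     \<parallel> vassoc_inv A w' (cmp K g) v \<parallel> (\<alpha>' \<triangleleft> v) \<parallel> vassoc A (cmp K h) v' v"

lemma retro_hpaste_hcell:
  "retro_hpaste A K (Retro f v w g \<alpha>) (Retro h w' x k \<beta>) = Retro (h \<odot> f) v x (k \<odot> g) (retro_hcell
      f v w g \<alpha> h x k \<beta>)"
  by (simp add: retro_hcell_def whisk_left_def whisk_right_def)

lemma retro_vpaste_vcell:
  "retro_vpaste A K (Retro f v w g \<alpha>) (Retro g' v' w' h \<alpha>') = Retro f (v' \<bullet> v) (w' \<bullet> w) h
      (retro_vcell f v w g \<alpha> v' w' h \<alpha>')"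
  by (simp add: retro_vcell_def whisk_left_def whisk_right_def)

text \<open>
On components, horizontal pasting of retrocells is the pasting of natural families, conjugated by the
comparison cells for companions.
\<close>

lemma retro_hcell:
  assumes "retro_square \<alpha> f v w g a b c d" "retro_square \<beta> h w x k b e d e'"
  shows "retro_square (retro_hcell f v w g \<alpha> h x k \<beta>) (h \<odot> f) v x (k \<odot> g) a e c e'"
    and "y \<in> Ver A \<Longrightarrow> vcod A y = a \<Longrightarrow>
      retro_component (h \<odot> f) v x (k \<odot> g) (retro_hcell f v w g \<alpha> h x k \<beta>) y
      = (x \<triangleright> split_at h f y) \<parallel> (retro_component h w x k \<beta> (cmp K f \<bullet> y) \<parallel>
        ((cmp K k \<triangleright> retro_component f v w g \<alpha> y) \<parallel> merge_at k g (v \<bullet> y)))"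
proof -
  note D = retro_squareD[OF assms(1)] and D' = retro_squareD[OF assms(2)]
  note hf = hcomp_arr[OF D(1) D'(1)] and kg = hcomp_arr[OF D(2) D'(2)]
  note [simp] = assms[unfolded retro_square_unfold] hf[unfolded harr_def] kg[unfolded harr_def]
    cmp_varr[OF hf, unfolded varr_def] cmp_varr[OF kg, unfolded varr_def]
    cmp_split_merge(1)[OF D(1) D'(1), unfolded globular_iff]
    cmp_split_merge(2)[OF D(2) D'(2), unfolded globular_iff]
  show "retro_square (retro_hcell f v w g \<alpha> h x k \<beta>) (h \<odot> f) v x (k \<odot> g) a e c e'"
    by (simp add: retro_hcell_def retro_square_unfold glob_assoc)
  show "retro_component (h \<odot> f) v x (k \<odot> g) (retro_hcell f v w g \<alpha> h x k \<beta>) y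
      = (x \<triangleright> split_at h f y) \<parallel> (retro_component h w x k \<beta> (cmp K f \<bullet> y) \<parallel>
        ((cmp K k \<triangleright> retro_component f v w g \<alpha> y) \<parallel> merge_at k g (v \<bullet> y)))"
    if "y \<in> Ver A" "vcod A y = a"
    unfolding retro_hcell_def split_at_def merge_at_def
    by (rule component_hcomp[OF D(3) D'(3) cmp_split_merge(1)[OF D(1) D'(1)] cmp_split_merge(2)[OF
        D(2) D'(2)]
          cmp_varr[OF hf] cmp_varr[OF kg] that])
qed

text \<open>
On components, vertical pasting of retrocells is composition of the families; the outer associators
only replace \<open>(w' \<bullet> w) \<bullet> _\<close> and \<open>(v' \<bullet> v) \<bullet> _\<close> by two successive actions.
\<close>

lemma retro_vcell:
  assumes "retro_square \<alpha> f v w g a b c d" "retro_square \<alpha>' g v' w' h c d e e'"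
  shows "retro_square (retro_vcell f v w g \<alpha> v' w' h \<alpha>') f (v' \<bullet> v) (w' \<bullet> w) h a b e e'"
    and "y \<in> Ver A \<Longrightarrow> vcod A y = a \<Longrightarrow>
      retro_component f (v' \<bullet> v) (w' \<bullet> w) h (retro_vcell f v w g \<alpha> v' w' h \<alpha>') y
      = vassoc A w' w (cmp K f \<bullet> y) \<parallel> ((w' \<triangleright> retro_component f v w g \<alpha> y) \<parallel>
        (retro_component g v' w' h \<alpha>' (v \<bullet> y) \<parallel> (cmp K h \<triangleright> vassoc_inv A v' v y)))"
proof -
  note D = retro_squareD[OF assms(1)] and D' = retro_squareD[OF assms(2)]
  note [simp] = assms[unfolded retro_square_unfold]
  show "retro_square (retro_vcell f v w g \<alpha> v' w' h \<alpha>') f (v' \<bullet> v) (w' \<bullet> w) h a b e e'"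
    by (simp add: retro_vcell_def retro_square_unfold glob_assoc)
  show "retro_component f (v' \<bullet> v) (w' \<bullet> w) h (retro_vcell f v w g \<alpha> v' w' h \<alpha>') y
      = vassoc A w' w (cmp K f \<bullet> y) \<parallel> ((w' \<triangleright> retro_component f v w g \<alpha> y) \<parallel>
        (retro_component g v' w' h \<alpha>' (v \<bullet> y) \<parallel> (cmp K h \<triangleright> vassoc_inv A v' v y)))"
    if "y \<in> Ver A" "vcod A y = a"
    unfolding retro_vcell_def by (rule component_vcomp[OF D(3) D'(3) that])
qed

text \<open>
The chosen companion of an identity is an identity, so globular retrocells from \<open>v\<close> to \<open>w\<close> are
globular cells from \<open>w\<close> to \<open>v\<close>: the direction is reversed.
\<close>

lemma retro_square_globular:
  assumes "varr A v a c" "varr A w a c"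
  shows "retro_square \<alpha> (hid A a) v w (hid A c) a a c c \<longleftrightarrow> globular A \<alpha> w v"
  using assms by (auto simp: retro_square_iff varr_def hid_arr)

lemma retro_hidc_square:
  assumes "varr A v a c"
  shows "retro_hidc A v = Retro (hid A a) v v (hid A c) (hidc A v)"
    "retro_square (hidc A v) (hid A a) v v (hid A c) a a c c"
  using assms by (auto simp: retro_hidc_def retro_square_globular globular_iff varr_def)

lemma retro_vidc_square:
  assumes "harr A f a b"
  shows "retro_vidc A K f = Retro f (vid A a) (vid A b) f (hidc A (cmp K f))"
    "retro_square (hidc A (cmp K f)) f (vid A a) (vid A b) f a b a b"
  using assms harr_obj[OF assms] cmp_varr[OF assms]
  by (auto simp: retro_vidc_def retro_square_unfold)

lemma retro_component_vidc:
  assumes "harr A f a b" "y \<in> Ver A" "vcod A y = a"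
  shows "retro_component f (vid A a) (vid A b) f (hidc A (cmp K f)) y = hidc A (cmp K f \<bullet> y)"
  using assms harr_obj[OF assms(1)] cmp_varr[OF assms(1)]
  by (simp add: component_def varr_def)

lemma retro_hidc_hpaste:
  assumes "cell (Ret A K) \<rho> f v w g"
  shows "retro_hpaste A K (retro_hidc A v) \<rho> = \<rho>" "retro_hpaste A K \<rho> (retro_hidc A w) = \<rho>"
proof -
  obtain \<alpha> a b c d where \<rho>: "\<rho> = Retro f v w g \<alpha>" and sq: "retro_square \<alpha> f v w g a b c d"
    using Ret_cellE[OF assms] .
  note D = retro_squareD[OF sq]
  note [simp] = sq[unfolded retro_square_unfold] component_simps[OF D(3)]
    hcomp_hid[OF D(1)] hcomp_hid[OF D(2)] hid_hcomp[OF D(1)] hid_hcomp[OF D(2)]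
    split_at_unit[OF D(1)] split_at_unit[OF D(2)]
    harr_obj[OF D(1)] harr_obj[OF D(2)]
  have v: "varr A v a c" and w: "varr A w b d" by (simp_all add: varr_def)
  have gv: "globular A (hidc A v) v v" and gw: "globular A (hidc A w) w w" by (simp_all add:
      globular_iff)
  note L = retro_hcell[OF retro_hidc_square(2)[OF v] sq] and R = retro_hcell[OF sq
      retro_hidc_square(2)[OF w]]
  have "retro_hcell (hid A a) v v (hid A c) (hidc A v) f w g \<alpha> = \<alpha>"
    using L by (intro retro_square_eqI[OF _ sq])
      (simp_all add: component_globular[OF v v gv])
  then show "retro_hpaste A K (retro_hidc A v) \<rho> = \<rho>"
    by (simp add: retro_hidc_square(1)[OF v] \<rho> retro_hpaste_hcell del: retro_hpaste.simps)
  have "retro_hcell f v w g \<alpha> (hid A b) w (hid A d) (hidc A w) = \<alpha>"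
    using R by (intro retro_square_eqI[OF _ sq])
      (simp_all add: component_globular[OF w w gw])
  then show "retro_hpaste A K \<rho> (retro_hidc A w) = \<rho>"
    by (simp add: retro_hidc_square(1)[OF w] \<rho> retro_hpaste_hcell del: retro_hpaste.simps)
qed

lemma retro_vidc_vpaste:
  assumes "cell (Ret A K) \<rho> f v w g"
  shows "retro_vpaste A K (retro_vidc A K f) \<rho> = \<rho>" "retro_vpaste A K \<rho> (retro_vidc A K g) = \<rho>"
proof -
  obtain \<alpha> a b c d where \<rho>: "\<rho> = Retro f v w g \<alpha>" and sq: "retro_square \<alpha> f v w g a b c d"
    using Ret_cellE[OF assms] .
  note D = retro_squareD[OF sq]
  note [simp] = sq[unfolded retro_square_unfold] component_simps[OF D(3)]
    harr_obj[OF D(1)] harr_obj[OF D(2)]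
  note U = retro_vcell[OF retro_vidc_square(2)[OF D(1)] sq] and L = retro_vcell[OF sq
      retro_vidc_square(2)[OF D(2)]]
  have "retro_vcell f (vid A a) (vid A b) f (hidc A (cmp K f)) v w g \<alpha> = \<alpha>"
    using U by (intro retro_square_eqI[OF _ sq]) (simp_all add: retro_component_vidc[OF D(1)])
  then show "retro_vpaste A K (retro_vidc A K f) \<rho> = \<rho>"
    by (simp add: retro_vidc_square(1)[OF D(1)] \<rho> retro_vpaste_vcell del: retro_vpaste.simps)
  have "retro_vcell f v w g \<alpha> (vid A c) (vid A d) g (hidc A (cmp K g)) = \<alpha>"
    using L by (intro retro_square_eqI[OF _ sq]) (simp_all add: retro_component_vidc[OF D(2)])
  then show "retro_vpaste A K \<rho> (retro_vidc A K g) = \<rho>"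
    by (simp add: retro_vidc_square(1)[OF D(2)] \<rho> retro_vpaste_vcell del: retro_vpaste.simps)
qed


text \<open>
In components, both sides consist of \<open>\<gamma>\<close>, \<open>\<beta>\<close>, \<open>\<alpha>\<close> one after the other, between comparison cells.
Naturality of \<open>\<gamma>\<close> and of \<open>merge_at\<close> brings the comparison cells to the two ends, where they agree by
coherence.
\<close>

lemma retro_hpaste_assoc:
  assumes "cell (Ret A K) \<rho> f v w g" "cell (Ret A K) \<sigma> h w x k" "cell (Ret A K) \<tau> l x u m"
  shows "retro_hpaste A K (retro_hpaste A K \<rho> \<sigma>) \<tau> = retro_hpaste A K \<rho> (retro_hpaste A K \<sigma> \<tau>)"
proof -
  obtain \<alpha> a b c d where \<rho>: "\<rho> = Retro f v w g \<alpha>" and \<alpha>: "retro_square \<alpha> f v w g a b c d"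
    using Ret_cellE[OF assms(1)] .
  obtain \<beta> e e' where \<sigma>: "\<sigma> = Retro h w x k \<beta>" and \<beta>: "retro_square \<beta> h w x k b e d e'"
    using Ret_cellE[OF assms(2)] retro_square_corners[OF \<alpha>] retro_square_corners by metis
  obtain \<gamma> i i' where \<tau>: "\<tau> = Retro l x u m \<gamma>" and \<gamma>: "retro_square \<gamma> l x u m e i e' i'"
    using Ret_cellE[OF assms(3)] retro_square_corners[OF \<beta>] retro_square_corners by metis
  note Da = retro_squareD[OF \<alpha>] and Db = retro_squareD[OF \<beta>] and Dc = retro_squareD[OF \<gamma>]
  note f = Da(1) and g = Da(2) and h = Db(1) and k = Db(2) and l = Dc(1) and m = Dc(2)
  note hf = hcomp_arr[OF f h] and lh = hcomp_arr[OF h l] and kg = hcomp_arr[OF g k] and mk =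
      hcomp_arr[OF k m]
  note lhf = hcomp_arr[OF hf l] and mkg = hcomp_arr[OF kg m]
  note as = hcomp_assoc[OF f h l] hcomp_assoc[OF g k m]
  note ab = retro_hcell[OF \<alpha> \<beta>] and bc = retro_hcell[OF \<beta> \<gamma>]
  note ab_c = retro_hcell[OF ab(1) \<gamma>] and a_bc = retro_hcell[OF \<alpha> bc(1), unfolded as]
  have "retro_hcell (h \<odot> f) v x (k \<odot> g) (retro_hcell f v w g \<alpha> h x k \<beta>) l u m \<gamma>
    = retro_hcell f v w g \<alpha> (l \<odot> h) u (m \<odot> k) (retro_hcell h w x k \<beta> l u m \<gamma>)" (is "?L = ?R")
  proof (rule retro_square_eqI[OF ab_c(1) a_bc(1)])
    fix y assume y: "y \<in> Ver A" "vcod A y = a"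
    note [simp] = y \<alpha>[unfolded retro_square_unfold] \<beta>[unfolded retro_square_unfold] \<gamma>[unfolded
        retro_square_unfold]
      component_simps[OF Da(3)] component_simps[OF Db(3)] component_simps[OF Dc(3)]
      cmp_varr[OF hf, unfolded varr_def] cmp_varr[OF lh, unfolded varr_def] cmp_varr[OF kg,
          unfolded varr_def]
      cmp_varr[OF mk, unfolded varr_def] cmp_varr[OF lhf, unfolded varr_def] cmp_varr[OF mkg,
          unfolded varr_def]
      split_merge_at[OF f h] split_merge_at[OF h l] split_merge_at[OF f lh, unfolded as]
          split_merge_at[OF hf l]
      split_merge_at[OF g k] split_merge_at[OF k m] split_merge_at[OF g mk, unfolded as]
          split_merge_at[OF kg m]
    let ?\<alpha> = "retro_component f v w g \<alpha> y"
    \<comment> \<open>\<open>M\<close> and \<open>MM\<close> move the lower comparison cells past \<open>\<alpha>\<close> to the end of the chain, \<open>G\<close> and \<open>SS\<close>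
      move the upper ones past \<open>\<gamma>\<close> to its beginning.\<close>
    have M: "merge_at m k (w \<bullet> (cmp K f \<bullet> y)) \<parallel> (cmp K (m \<odot> k) \<triangleright> ?\<alpha>)
        = (cmp K m \<triangleright> (cmp K k \<triangleright> ?\<alpha>)) \<parallel> merge_at m k (cmp K g \<bullet> (v \<bullet> y))"
      by (rule split_merge_natural[OF k m]) simp_all
    have MM: "merge_at m k (cmp K g \<bullet> (v \<bullet> y)) \<parallel> merge_at (m \<odot> k) g (v \<bullet> y)
        = (cmp K m \<triangleright> merge_at k g (v \<bullet> y)) \<parallel> merge_at m (k \<odot> g) (v \<bullet> y)"
      by (rule merge_at_assoc[OF g k m]) simp_all
    have G: "retro_component l x u m \<gamma> (cmp K (h \<odot> f) \<bullet> y) \<parallel> (cmp K m \<triangleright> (x \<triangleright> split_at h f y))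
        = (u \<triangleright> (cmp K l \<triangleright> split_at h f y)) \<parallel> retro_component l x u m \<gamma> (cmp K h \<bullet> (cmp K f \<bullet> y))"
      by (rule component_natural[OF Dc(3), symmetric]) (simp_all add: globular_iff)
    have SS: "(u \<triangleright> split_at l (h \<odot> f) y) \<parallel> (u \<triangleright> (cmp K l \<triangleright> split_at h f y))
        = (u \<triangleright> split_at (l \<odot> h) f y) \<parallel> (u \<triangleright> split_at l h (cmp K f \<bullet> y))"
      using split_at_assoc[OF f h l y] by (simp flip: whisk_left_hpaste)
    have L: "retro_component (l \<odot> (h \<odot> f)) v u (m \<odot> (k \<odot> g)) ?L y
      = (u \<triangleright> split_at (l \<odot> h) f y) \<parallel> ((u \<triangleright> split_at l h (cmp K f \<bullet> y)) \<parallel>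
        (retro_component l x u m \<gamma> (cmp K h \<bullet> (cmp K f \<bullet> y)) \<parallel> ((cmp K m \<triangleright> retro_component h w x k
            \<beta> (cmp K f \<bullet> y)) \<parallel>
        ((cmp K m \<triangleright> (cmp K k \<triangleright> ?\<alpha>)) \<parallel> ((cmp K m \<triangleright> merge_at k g (v \<bullet> y)) \<parallel> merge_at m (k \<odot> g) (v \<bullet>
            y))))))"
      by (simp add: ab_c(2) ab(2) glob_assoc whisk_left_hpaste hpaste_tail[OF G] hpaste_tail[OF
          SS])
    have R: "retro_component (l \<odot> (h \<odot> f)) v u (m \<odot> (k \<odot> g)) ?R y
      = (u \<triangleright> split_at (l \<odot> h) f y) \<parallel> ((u \<triangleright> split_at l h (cmp K f \<bullet> y)) \<parallel>
        (retro_component l x u m \<gamma> (cmp K h \<bullet> (cmp K f \<bullet> y)) \<parallel> ((cmp K m \<triangleright> retro_component h w x k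
            \<beta> (cmp K f \<bullet> y)) \<parallel>
        ((cmp K m \<triangleright> (cmp K k \<triangleright> ?\<alpha>)) \<parallel> ((cmp K m \<triangleright> merge_at k g (v \<bullet> y)) \<parallel> merge_at m (k \<odot> g) (v \<bullet>
            y))))))"
      by (simp add: a_bc(2) bc(2) glob_assoc whisk_left_hpaste hpaste_tail[OF M] MM)
    show "retro_component (l \<odot> (h \<odot> f)) v u (m \<odot> (k \<odot> g)) ?L y
      = retro_component (l \<odot> (h \<odot> f)) v u (m \<odot> (k \<odot> g)) ?R y"
      by (simp only: L R)
  qed
  then show ?thesis
    by (simp add: \<rho> \<sigma> \<tau> retro_hpaste_hcell as del: retro_hpaste.simps)
qed

text \<open>
The factors \<open>\<alpha>\<close> and \<open>\<beta>'\<close> occur in opposite orders on the two sides; naturality of \<open>\<beta>'\<close> exchanges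
them.  Between the two rows, \<open>merge_at\<close> meets \<open>split_at\<close> for the middle arrow and cancels.
\<close>

lemma retro_interchange:
  assumes "cell (Ret A K) \<rho> f v w g" "cell (Ret A K) \<sigma> h w x k"
    and "cell (Ret A K) \<rho>' g v' w' f'" "cell (Ret A K) \<sigma>' k w' x' h'"
  shows "retro_vpaste A K (retro_hpaste A K \<rho> \<sigma>) (retro_hpaste A K \<rho>' \<sigma>')
    = retro_hpaste A K (retro_vpaste A K \<rho> \<rho>') (retro_vpaste A K \<sigma> \<sigma>')"
proof -
  obtain \<alpha> a b c d where \<rho>: "\<rho> = Retro f v w g \<alpha>" and \<alpha>: "retro_square \<alpha> f v w g a b c d"
    using Ret_cellE[OF assms(1)] .
  obtain \<beta> e e' where \<sigma>: "\<sigma> = Retro h w x k \<beta>" and \<beta>: "retro_square \<beta> h w x k b e d e'"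
    using Ret_cellE[OF assms(2)] retro_square_corners[OF \<alpha>] retro_square_corners by metis
  obtain \<alpha>' i j where \<rho>': "\<rho>' = Retro g v' w' f' \<alpha>'" and \<alpha>': "retro_square \<alpha>' g v' w' f' c d i j"
    using Ret_cellE[OF assms(3)] retro_square_corners[OF \<alpha>] retro_square_corners by metis
  obtain \<beta>' j' where \<sigma>': "\<sigma>' = Retro k w' x' h' \<beta>'" and \<beta>': "retro_square \<beta>' k w' x' h' d e' j j'"
    using Ret_cellE[OF assms(4)] retro_square_corners[OF \<beta>] retro_square_corners[OF \<alpha>']
        retro_square_corners by metis
  note Da = retro_squareD[OF \<alpha>] and Db = retro_squareD[OF \<beta>] and Da' = retro_squareD[OF \<alpha>'] and
      Db' = retro_squareD[OF \<beta>']
  note f = Da(1) and g = Da(2) and h = Db(1) and k = Db(2) and f' = Da'(2) and h' = Db'(2)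
  note hf = hcomp_arr[OF f h] and kg = hcomp_arr[OF g k] and hf' = hcomp_arr[OF f' h']
  note ab = retro_hcell[OF \<alpha> \<beta>] and ab' = retro_hcell[OF \<alpha>' \<beta>'] and aa = retro_vcell[OF \<alpha> \<alpha>'] and
      bb = retro_vcell[OF \<beta> \<beta>']
  note V = retro_vcell[OF ab(1) ab'(1)] and H = retro_hcell[OF aa(1) bb(1)]
  have "retro_vcell (h \<odot> f) v x (k \<odot> g) (retro_hcell f v w g \<alpha> h x k \<beta>) v' x' (h' \<odot> f')
      (retro_hcell g v' w' f' \<alpha>' k x' h' \<beta>')
    = retro_hcell f (v' \<bullet> v) (w' \<bullet> w) f' (retro_vcell f v w g \<alpha> v' w' f' \<alpha>') h (x' \<bullet> x) h'
        (retro_vcell h w x k \<beta> w' x' h' \<beta>')" (is "?V = ?H")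
  proof (rule retro_square_eqI[OF V(1) H(1)])
    fix y assume y: "y \<in> Ver A" "vcod A y = a"
    note [simp] = y \<alpha>[unfolded retro_square_unfold] \<beta>[unfolded retro_square_unfold]
      \<alpha>'[unfolded retro_square_unfold] \<beta>'[unfolded retro_square_unfold]
      component_simps[OF Da(3)] component_simps[OF Db(3)] component_simps[OF Da'(3)]
          component_simps[OF Db'(3)]
      cmp_varr[OF hf, unfolded varr_def] cmp_varr[OF kg, unfolded varr_def] cmp_varr[OF hf',
          unfolded varr_def]
      split_merge_at[OF f h] split_merge_at[OF g k] split_merge_at[OF f' h']
    let ?\<alpha> = "retro_component f v w g \<alpha> y" and ?\<alpha>' = "retro_component g v' w' f' \<alpha>' (v \<bullet> y)"
    \<comment> \<open>\<open>MS\<close>, \<open>N\<close>, \<open>M\<close> normalise the vertical composite of the rows; \<open>S\<close> and \<open>C\<close> do so for the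
      horizontal composite of the columns.\<close>
    have MS: "(x' \<triangleright> merge_at k g (v \<bullet> y)) \<parallel> (x' \<triangleright> split_at k g (v \<bullet> y)) = hidc A (x' \<bullet> (cmp K k \<bullet>
        (cmp K g \<bullet> (v \<bullet> y))))"
      by (simp flip: whisk_left_hpaste)
    have N: "(x' \<triangleright> (cmp K k \<triangleright> ?\<alpha>)) \<parallel> retro_component k w' x' h' \<beta>' (cmp K g \<bullet> (v \<bullet> y))
       = retro_component k w' x' h' \<beta>' (w \<bullet> (cmp K f \<bullet> y)) \<parallel> (cmp K h' \<triangleright> (w' \<triangleright> ?\<alpha>))"
      by (rule component_natural[OF Db'(3)]) (simp_all add: globular_iff)
    have M: "merge_at h' f' (v' \<bullet> (v \<bullet> y)) \<parallel> (cmp K (h' \<odot> f') \<triangleright> vassoc_inv A v' v y)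
       = (cmp K h' \<triangleright> (cmp K f' \<triangleright> vassoc_inv A v' v y)) \<parallel> merge_at h' f' ((v' \<bullet> v) \<bullet> y)"
      by (rule split_merge_natural[OF f' h']) simp_all
    have S: "((x' \<bullet> x) \<triangleright> split_at h f y) \<parallel> vassoc A x' x (cmp K h \<bullet> (cmp K f \<bullet> y))
       = vassoc A x' x (cmp K (h \<odot> f) \<bullet> y) \<parallel> (x' \<triangleright> (x \<triangleright> split_at h f y))"
      by (rule vassoc_whisk(1)[symmetric]) simp_all
    have C: "(cmp K h' \<triangleright> vassoc_inv A w' w (cmp K f \<bullet> y)) \<parallel> (cmp K h' \<triangleright> vassoc A w' w (cmp K f \<bullet>
        y))
       = hidc A (cmp K h' \<bullet> (w' \<bullet> (w \<bullet> (cmp K f \<bullet> y))))"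
      by (simp flip: whisk_left_hpaste)
    have V': "retro_component (h \<odot> f) (v' \<bullet> v) (x' \<bullet> x) (h' \<odot> f') ?V y
      = vassoc A x' x (cmp K (h \<odot> f) \<bullet> y) \<parallel> ((x' \<triangleright> (x \<triangleright> split_at h f y)) \<parallel>
        ((x' \<triangleright> retro_component h w x k \<beta> (cmp K f \<bullet> y)) \<parallel>
        (retro_component k w' x' h' \<beta>' (w \<bullet> (cmp K f \<bullet> y)) \<parallel> ((cmp K h' \<triangleright> (w' \<triangleright> ?\<alpha>)) \<parallel> ((cmp K h'
            \<triangleright> ?\<alpha>') \<parallel>
        ((cmp K h' \<triangleright> (cmp K f' \<triangleright> vassoc_inv A v' v y)) \<parallel> merge_at h' f' ((v' \<bullet> v) \<bullet> y)))))))"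
      by (simp add: V(2) ab(2) ab'(2) glob_assoc whisk_left_hpaste hpaste_tail[OF MS]
          hpaste_tail[OF N] M)
    have H': "retro_component (h \<odot> f) (v' \<bullet> v) (x' \<bullet> x) (h' \<odot> f') ?H y
      = vassoc A x' x (cmp K (h \<odot> f) \<bullet> y) \<parallel> ((x' \<triangleright> (x \<triangleright> split_at h f y)) \<parallel>
        ((x' \<triangleright> retro_component h w x k \<beta> (cmp K f \<bullet> y)) \<parallel>
        (retro_component k w' x' h' \<beta>' (w \<bullet> (cmp K f \<bullet> y)) \<parallel> ((cmp K h' \<triangleright> (w' \<triangleright> ?\<alpha>)) \<parallel> ((cmp K h'
            \<triangleright> ?\<alpha>') \<parallel>
        ((cmp K h' \<triangleright> (cmp K f' \<triangleright> vassoc_inv A v' v y)) \<parallel> merge_at h' f' ((v' \<bullet> v) \<bullet> y)))))))"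
      by (simp add: H(2) aa(2) bb(2) glob_assoc whisk_left_hpaste hpaste_tail[OF S] hpaste_tail[OF
          C])
    show "retro_component (h \<odot> f) (v' \<bullet> v) (x' \<bullet> x) (h' \<odot> f') ?V y
      = retro_component (h \<odot> f) (v' \<bullet> v) (x' \<bullet> x) (h' \<odot> f') ?H y"
      by (simp only: V' H')
  qed
  then show ?thesis
    by (simp add: \<rho> \<sigma> \<rho>' \<sigma>' retro_hpaste_hcell retro_vpaste_vcell del: retro_hpaste.simps
        retro_vpaste.simps)
qed

section \<open>The remaining axioms of a double category\<close>

lemma retro_hpaste_cell:
  assumes "cell (Ret A K) \<rho> f v w g" "cell (Ret A K) \<sigma> h w x k"
  shows "cell (Ret A K) (retro_hpaste A K \<rho> \<sigma>) (h \<odot> f) v x (k \<odot> g)"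
proof -
  obtain \<alpha> a b c d where \<rho>: "\<rho> = Retro f v w g \<alpha>" and \<alpha>: "retro_square \<alpha> f v w g a b c d"
    using Ret_cellE[OF assms(1)] .
  obtain \<beta> e e' where \<sigma>: "\<sigma> = Retro h w x k \<beta>" and \<beta>: "retro_square \<beta> h w x k b e d e'"
    using Ret_cellE[OF assms(2)] retro_square_corners[OF \<alpha>] retro_square_corners by metis
  show ?thesis
    using retro_hcell(1)[OF \<alpha> \<beta>] unfolding \<rho> \<sigma> retro_hpaste_hcell Ret_cell by blast
qed

lemma retro_vpaste_cell:
  assumes "cell (Ret A K) \<rho> f v w g" "cell (Ret A K) \<rho>' g v' w' h"
  shows "cell (Ret A K) (retro_vpaste A K \<rho> \<rho>') f (v' \<bullet> v) (w' \<bullet> w) h"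
proof -
  obtain \<alpha> a b c d where \<rho>: "\<rho> = Retro f v w g \<alpha>" and \<alpha>: "retro_square \<alpha> f v w g a b c d"
    using Ret_cellE[OF assms(1)] .
  obtain \<alpha>' e e' where \<rho>': "\<rho>' = Retro g v' w' h \<alpha>'" and \<alpha>': "retro_square \<alpha>' g v' w' h c d e e'"
    using Ret_cellE[OF assms(2)] retro_square_corners[OF \<alpha>] retro_square_corners by metis
  show ?thesis
    using retro_vcell(1)[OF \<alpha> \<alpha>'] unfolding \<rho> \<rho>' retro_vpaste_vcell Ret_cell by blast
qed

lemma retro_vidc_hcomp:
  assumes f: "harr A f a b" and g: "harr A g b c"
  shows "retro_vidc A K (g \<odot> f) = retro_hpaste A K (retro_vidc A K f) (retro_vidc A K g)"
proof -
  note gf = hcomp_arr[OF f g]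
  note F = retro_vidc_square[OF f] and G = retro_vidc_square[OF g] and GF = retro_vidc_square[OF
      gf]
  note H = retro_hcell[OF F(2) G(2)]
  have "retro_hcell f (vid A a) (vid A b) f (hidc A (cmp K f)) g (vid A c) g (hidc A (cmp K g)) =
      hidc A (cmp K (g \<odot> f))"
    (is "?H = _")
  proof (rule retro_square_eqI[OF H(1) GF(2)])
    fix y assume y: "y \<in> Ver A" "vcod A y = a"
    note [simp] = y F(2)[unfolded retro_square_unfold] G(2)[unfolded retro_square_unfold]
      cmp_varr[OF gf, unfolded varr_def] harr_obj[OF f] harr_obj[OF g] split_merge_at[OF f g]
      retro_component_vidc[OF f] retro_component_vidc[OF g] retro_component_vidc[OF gf]
    show "retro_component (g \<odot> f) (vid A a) (vid A c) (g \<odot> f) ?H y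
      = retro_component (g \<odot> f) (vid A a) (vid A c) (g \<odot> f) (hidc A (cmp K (g \<odot> f))) y"
      by (simp add: H(2))
  qed
  then show ?thesis
    by (simp add: F(1) G(1) GF(1) retro_hpaste_hcell del: retro_hpaste.simps)
qed

lemma retro_vcell_globular:
  assumes "varr A v a c" "varr A w a c" "globular A \<alpha> w v" "varr A v' c d" "varr A w' c d"
      "globular A \<alpha>' w' v'"
  shows "retro_vcell (hid A a) v w (hid A c) \<alpha> v' w' (hid A d) \<alpha>' = (w' \<triangleright> \<alpha>) \<parallel> (\<alpha>' \<triangleleft> v)"
proof -
  note [simp] = assms[unfolded varr_def globular_iff] varr_obj[OF assms(1)] varr_obj[OF assms(4)]
  show ?thesis by (simp add: retro_vcell_def)
qed

lemma retro_hcell_globular_right: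
  assumes "retro_square \<alpha> f v w g a b c d" "varr A x b d" "globular A \<beta> x w"
  shows "retro_hcell f v w g \<alpha> (hid A b) x (hid A d) \<beta> = (\<beta> \<triangleleft> cmp K f) \<parallel> \<alpha>"
proof -
  note [simp] = assms[unfolded varr_def globular_iff retro_square_unfold]
  note D = retro_squareD[OF assms(1)]
  note [simp] = cmp_split_unit[OF D(1)] cmp_merge_unit[OF D(2)] harr_obj[OF D(1)] harr_obj[OF
      D(2)]
  show ?thesis by (simp add: retro_hcell_def)
qed

lemma retro_hidc_vcomp:
  assumes v: "varr A v a b" and w: "varr A w b c"
  shows "retro_hidc A (w \<bullet> v) = retro_vpaste A K (retro_hidc A v) (retro_hidc A w)"
proof -
  note wv = vcomp_arr[OF v w]
  have "retro_vcell (hid A a) v v (hid A b) (hidc A v) w w (hid A c) (hidc A w) = hidc A (w \<bullet> v)"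
    using v w by (subst retro_vcell_globular[of v a b v _ w c w]) (auto simp: varr_def
        globular_iff)
  then show ?thesis
    by (simp add: retro_hidc_square(1)[OF v] retro_hidc_square(1)[OF w] retro_hidc_square(1)[OF
        wv]
        retro_vpaste_vcell del: retro_vpaste.simps)
qed

text \<open>
Horizontal pasting of globular retrocells is the pasting of their underlying cells in reverse order.
\<close>

lemma retro_hpaste_globular:
  assumes "varr A v a c" "varr A w a c" "varr A x a c" "globular A \<alpha> w v" "globular A \<beta> x w"
  shows "retro_hpaste A K (Retro (hid A a) v w (hid A c) \<alpha>) (Retro (hid A a) w x (hid A c) \<beta>)
    = Retro (hid A a) v x (hid A c) (\<beta> \<parallel> \<alpha>)"
proof -
  note o = varr_obj[OF assms(1)]
  have "retro_hcell (hid A a) v w (hid A c) \<alpha> (hid A a) x (hid A c) \<beta> = (\<beta> \<triangleleft> cmp K (hid A a)) \<parallel> \<alpha>"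
    by (rule retro_hcell_globular_right[OF retro_square_globular[OF assms(1,2), THEN iffD2, OF
        assms(4)]
          assms(3,5)])
  then show ?thesis
    using assms o hcomp_hid[OF hid_arr, of a] hcomp_hid[OF hid_arr, of c]
    by (simp add: retro_hpaste_hcell globular_iff varr_def del: retro_hpaste.simps)
qed

lemma Ret_globular:
  assumes "varr A v a c" "varr A w a c"
  shows "globular (Ret A K) (Retro (hid A a) v w (hid A c) \<alpha>) v w \<longleftrightarrow> globular A \<alpha> w v"
proof -
  have "globular (Ret A K) (Retro (hid A a) v w (hid A c) \<alpha>) v w
    \<longleftrightarrow> (\<exists>a' b' c' d'. retro_square \<alpha> (hid A a) v w (hid A c) a' b' c' d')"
    using assms(1) by (auto simp: globular_def Ret_cell varr_def)
  also have "\<dots> \<longleftrightarrow> retro_square \<alpha> (hid A a) v w (hid A c) a a c c"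
    using assms retro_square_corners by (fastforce simp: varr_def)
  also have "\<dots> \<longleftrightarrow> globular A \<alpha> w v"
    by (rule retro_square_globular[OF assms])
  finally show ?thesis .
qed

lemma retro_vassoc_iso:
  assumes "varr A v a b" "varr A w b c" "varr A x c d"
  shows "globular_iso (Ret A K) (retro_vassoc A x w v) ((x \<bullet> w) \<bullet> v) (x \<bullet> (w \<bullet> v))"
proof -
  note [simp] = assms[unfolded varr_def]
  have L: "varr A ((x \<bullet> w) \<bullet> v) a d" and R: "varr A (x \<bullet> (w \<bullet> v)) a d"
    by (simp_all add: varr_def)
  have eq: "retro_vassoc A x w v = Retro (hid A a) ((x \<bullet> w) \<bullet> v) (x \<bullet> (w \<bullet> v)) (hid A d)
      (vassoc_inv A x w v)"
    by (simp add: retro_vassoc_def)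
  have "inverse_cells (Ret A K) (retro_vassoc A x w v)
      (Retro (hid A a) (x \<bullet> (w \<bullet> v)) ((x \<bullet> w) \<bullet> v) (hid A d) (vassoc A x w v)) ((x \<bullet> w) \<bullet> v) (x \<bullet>
          (w \<bullet> v))"
    unfolding inverse_cells_def eq Ret_simps
    by (simp add: Ret_globular[OF L R] Ret_globular[OF R L] retro_hpaste_globular[OF L R L]
        retro_hpaste_globular[OF R L R] retro_hidc_square(1)[OF L] retro_hidc_square(1)[OF R]
            globular_iff
        del: retro_hpaste.simps)
  then show ?thesis unfolding globular_iso_def by blast
qed

lemma retro_vassoc_vid:
  assumes "varr A v a b" "varr A w b c"
  shows "retro_vassoc A w (vid A b) v = retro_hidc A (w \<bullet> v)"
  using assms varr_obj[OF assms(1)] by (simp add: retro_vassoc_def retro_hidc_def varr_def)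

text \<open>
This is the pentagon of \<open>A\<close> inverted: the associators of retrocells are inverse associators of \<open>A\<close>,
pasted in reverse order.
\<close>

lemma retro_pentagon:
  assumes v: "varr A v a b" and w: "varr A w b c" and x: "varr A x c d" and y: "varr A y d e"
  shows "retro_hpaste A K (retro_vassoc A (y \<bullet> x) w v) (retro_vassoc A y x (w \<bullet> v)) =
    retro_hpaste A K (retro_hpaste A K (retro_vpaste A K (retro_hidc A v) (retro_vassoc A y x w))
      (retro_vassoc A y (x \<bullet> w) v)) (retro_vpaste A K (retro_vassoc A x w v) (retro_hidc A y))"
proof -
  note [simp] = v[unfolded varr_def] w[unfolded varr_def] x[unfolded varr_def] y[unfolded
      varr_def]
  have U: "retro_vcell (hid A a) v v (hid A b) (hidc A v) ((y \<bullet> x) \<bullet> w) (y \<bullet> (x \<bullet> w)) (hid A e)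
      (vassoc_inv A y x w)
      = vassoc_inv A y x w \<triangleleft> v"
    by (subst retro_vcell_globular[of v a b]) (simp_all add: varr_def globular_iff)
  have D: "retro_vcell (hid A a) ((x \<bullet> w) \<bullet> v) (x \<bullet> (w \<bullet> v)) (hid A d) (vassoc_inv A x w v) y y
      (hid A e) (hidc A y)
      = y \<triangleright> vassoc_inv A x w v"
    by (subst retro_vcell_globular[of _ a d]) (simp_all add: varr_def globular_iff)
  have q: "(y \<triangleright> vassoc_inv A x w v) \<parallel> (y \<triangleright> vassoc A x w v) = hidc A (y \<bullet> (x \<bullet> (w \<bullet> v)))"
    by (simp flip: whisk_left_hpaste)
  have eq: "vassoc_inv A y x (w \<bullet> v) \<parallel> vassoc_inv A (y \<bullet> x) w v
    = (y \<triangleright> vassoc_inv A x w v) \<parallel> (vassoc_inv A y (x \<bullet> w) v \<parallel> (vassoc_inv A y x w \<triangleleft> v))"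
    by (simp add: pentagon_split(1) hpaste_tail[OF q])
  show ?thesis
    by (simp add: retro_vassoc_def retro_hidc_def retro_vpaste_vcell U D eq
        retro_hpaste_globular[of _ a e] varr_def globular_iff
        del: retro_hpaste.simps retro_vpaste.simps)
qed

text \<open>
In components, both sides perform \<open>\<alpha>\<close>, \<open>\<alpha>'\<close>, \<open>\<alpha>''\<close> successively; they differ by the bracketing of
\<open>w''\<close>, \<open>w'\<close>, \<open>w\<close> before and of \<open>v''\<close>, \<open>v'\<close>, \<open>v\<close> after.  The former is one instance of the pentagon,
the latter another.
\<close>

lemma retro_vassoc_natural:
  assumes "cell (Ret A K) \<rho> f v w g" "cell (Ret A K) \<rho>' g v' w' h" "cell (Ret A K) \<rho>'' h v'' w''
      k"
  shows "retro_hpaste A K (retro_vpaste A K \<rho> (retro_vpaste A K \<rho>' \<rho>'')) (retro_vassoc A w'' w' w)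
    = retro_hpaste A K (retro_vassoc A v'' v' v) (retro_vpaste A K (retro_vpaste A K \<rho> \<rho>') \<rho>'')"
proof -
  obtain \<alpha> a b c d where \<rho>: "\<rho> = Retro f v w g \<alpha>" and \<alpha>: "retro_square \<alpha> f v w g a b c d"
    using Ret_cellE[OF assms(1)] .
  obtain \<alpha>' i j where \<rho>': "\<rho>' = Retro g v' w' h \<alpha>'" and \<alpha>': "retro_square \<alpha>' g v' w' h c d i j"
    using Ret_cellE[OF assms(2)] retro_square_corners[OF \<alpha>] retro_square_corners by metis
  obtain \<alpha>'' m n where \<rho>'': "\<rho>'' = Retro h v'' w'' k \<alpha>''" and \<alpha>'': "retro_square \<alpha>'' h v'' w'' k i
      j m n"
    using Ret_cellE[OF assms(3)] retro_square_corners[OF \<alpha>'] retro_square_corners by metis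
  note Da = retro_squareD[OF \<alpha>] and Db = retro_squareD[OF \<alpha>'] and Dc = retro_squareD[OF \<alpha>'']
  note f = Da(1) and k = Dc(2)
  note [simp] = \<alpha>[unfolded retro_square_unfold] \<alpha>'[unfolded retro_square_unfold] \<alpha>''[unfolded
      retro_square_unfold]
    harr_obj[OF f] harr_obj[OF k] hcomp_hid[OF f] hcomp_hid[OF k] hid_hcomp[OF f] hid_hcomp[OF k]
    split_at_unit[OF f] split_at_unit[OF k]
  note ab = retro_vcell[OF \<alpha> \<alpha>'] and bc = retro_vcell[OF \<alpha>' \<alpha>'']
  note ab_c = retro_vcell[OF ab(1) \<alpha>''] and a_bc = retro_vcell[OF \<alpha> bc(1)]
  have V: "varr A (v'' \<bullet> (v' \<bullet> v)) a m" "varr A ((v'' \<bullet> v') \<bullet> v) a m"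
    and W: "varr A (w'' \<bullet> (w' \<bullet> w)) b n" "varr A ((w'' \<bullet> w') \<bullet> w) b n"
    by (simp_all add: varr_def)
  have gV: "globular A (vassoc_inv A v'' v' v) (v'' \<bullet> (v' \<bullet> v)) ((v'' \<bullet> v') \<bullet> v)"
    and gW: "globular A (vassoc_inv A w'' w' w) (w'' \<bullet> (w' \<bullet> w)) ((w'' \<bullet> w') \<bullet> w)"
    by (simp_all add: globular_iff)
  note X = retro_hcell[OF a_bc(1) retro_square_globular[OF W(2,1), THEN iffD2, OF gW]]
  note Y = retro_hcell[OF retro_square_globular[OF V(2,1), THEN iffD2, OF gV] ab_c(1)]
  let ?L = "retro_vcell f v w g \<alpha> (v'' \<bullet> v') (w'' \<bullet> w') k (retro_vcell g v' w' h \<alpha>' v'' w'' k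
      \<alpha>'')"
  let ?R = "retro_vcell f (v' \<bullet> v) (w' \<bullet> w) h (retro_vcell f v w g \<alpha> v' w' h \<alpha>') v'' w'' k \<alpha>''"
  let ?X = "retro_hcell f ((v'' \<bullet> v') \<bullet> v) ((w'' \<bullet> w') \<bullet> w) k ?L (hid A b) (w'' \<bullet> (w' \<bullet> w)) (hid A
      n) (vassoc_inv A w'' w' w)"
  let ?Y = "retro_hcell (hid A a) ((v'' \<bullet> v') \<bullet> v) (v'' \<bullet> (v' \<bullet> v)) (hid A m) (vassoc_inv A v'' v'
      v) f (w'' \<bullet> (w' \<bullet> w)) k ?R"
  have X1: "retro_square ?X f ((v'' \<bullet> v') \<bullet> v) (w'' \<bullet> (w' \<bullet> w)) k a b m n"
    and Y1: "retro_square ?Y f ((v'' \<bullet> v') \<bullet> v) (w'' \<bullet> (w' \<bullet> w)) k a b m n"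
    using X(1) Y(1) by simp_all
  have "?X = ?Y"
  proof (rule retro_square_eqI[OF X1 Y1])
    fix y assume y: "y \<in> Ver A" "vcod A y = a"
    note [simp] = y component_simps[OF Da(3)] component_simps[OF Db(3)] component_simps[OF Dc(3)]
      component_simps[OF retro_squareD(3)[OF ab_c(1)]] component_simps[OF retro_squareD(3)[OF
          a_bc(1)]]
      component_globular[OF V(2,1) gV] component_globular[OF W(2,1) gW]
    let ?\<alpha> = "retro_component f v w g \<alpha> y" and ?\<alpha>' = "retro_component g v' w' h \<alpha>' (v \<bullet> y)"
      and ?\<alpha>'' = "retro_component h v'' w'' k \<alpha>'' (v' \<bullet> (v \<bullet> y))"
    have X2: "retro_component f ((v'' \<bullet> v') \<bullet> v) (w'' \<bullet> (w' \<bullet> w)) k ?X y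
      = (vassoc_inv A w'' w' w \<triangleleft> (cmp K f \<bullet> y)) \<parallel> retro_component f ((v'' \<bullet> v') \<bullet> v) ((w'' \<bullet> w') \<bullet>
          w) k ?L y"
      using X(2)[OF y] by simp
    have Y2: "retro_component f ((v'' \<bullet> v') \<bullet> v) (w'' \<bullet> (w' \<bullet> w)) k ?Y y
      = retro_component f (v'' \<bullet> (v' \<bullet> v)) (w'' \<bullet> (w' \<bullet> w)) k ?R y \<parallel> (cmp K k \<triangleright> (vassoc_inv A v''
          v' v \<triangleleft> y))"
      using Y(2)[OF y] by simp
    \<comment> \<open>\<open>r1\<close> and \<open>r3\<close> gather the associators at the two ends of the chain; \<open>r2\<close> and \<open>r4\<close> are the
      pentagons that identify them there.\<close>
    have r1: "((w'' \<bullet> w') \<triangleright> ?\<alpha>) \<parallel> vassoc A w'' w' (cmp K g \<bullet> (v \<bullet> y))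
      = vassoc A w'' w' (w \<bullet> (cmp K f \<bullet> y)) \<parallel> (w'' \<triangleright> (w' \<triangleright> ?\<alpha>))"
      by (rule vassoc_whisk(1)[symmetric]) simp_all
    have inv: "(vassoc_inv A w'' w' w \<triangleleft> (cmp K f \<bullet> y)) \<parallel> (vassoc A w'' w' w \<triangleleft> (cmp K f \<bullet> y))
      = hidc A ((w'' \<bullet> (w' \<bullet> w)) \<bullet> (cmp K f \<bullet> y))"
      by (simp flip: whisk_right_hpaste)
    have r2: "(vassoc_inv A w'' w' w \<triangleleft> (cmp K f \<bullet> y)) \<parallel>
        (vassoc A (w'' \<bullet> w') w (cmp K f \<bullet> y) \<parallel> vassoc A w'' w' (w \<bullet> (cmp K f \<bullet> y)))
      = vassoc A w'' (w' \<bullet> w) (cmp K f \<bullet> y) \<parallel> (w'' \<triangleright> vassoc A w' w (cmp K f \<bullet> y))"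
      by (simp add: pentagon_whisk[symmetric] hpaste_tail[OF inv])
    have r3: "(w'' \<triangleright> (cmp K h \<triangleright> vassoc_inv A v' v y)) \<parallel> retro_component h v'' w'' k \<alpha>'' ((v' \<bullet> v)
        \<bullet> y)
      = ?\<alpha>'' \<parallel> (cmp K k \<triangleright> (v'' \<triangleright> vassoc_inv A v' v y))"
      by (rule component_natural[OF Dc(3)]) (simp_all add: globular_iff)
    have inv': "(v'' \<triangleright> vassoc_inv A v' v y) \<parallel> (v'' \<triangleright> vassoc A v' v y) = hidc A (v'' \<bullet> (v' \<bullet> (v \<bullet>
        y)))"
      by (simp flip: whisk_left_hpaste)
    have "vassoc_inv A v'' v' (v \<bullet> y) \<parallel> vassoc_inv A (v'' \<bullet> v') v y
      = (v'' \<triangleright> vassoc_inv A v' v y) \<parallel> (vassoc_inv A v'' (v' \<bullet> v) y \<parallel> (vassoc_inv A v'' v' v \<triangleleft> y))"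
      by (simp add: pentagon_split(1) hpaste_tail[OF inv'])
    from arg_cong[OF this, of "\<lambda>z. cmp K k \<triangleright> z"]
    have r4: "(cmp K k \<triangleright> vassoc_inv A v'' v' (v \<bullet> y)) \<parallel> (cmp K k \<triangleright> vassoc_inv A (v'' \<bullet> v') v y)
      = (cmp K k \<triangleright> (v'' \<triangleright> vassoc_inv A v' v y)) \<parallel>
        ((cmp K k \<triangleright> vassoc_inv A v'' (v' \<bullet> v) y) \<parallel> (cmp K k \<triangleright> (vassoc_inv A v'' v' v \<triangleleft> y)))"
      by (simp add: whisk_left_hpaste)
    show "retro_component f ((v'' \<bullet> v') \<bullet> v) (w'' \<bullet> (w' \<bullet> w)) k ?X y
      = retro_component f ((v'' \<bullet> v') \<bullet> v) (w'' \<bullet> (w' \<bullet> w)) k ?Y y"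
    proof -
      let ?F = "cmp K f \<bullet> y"
      have "retro_component f ((v'' \<bullet> v') \<bullet> v) (w'' \<bullet> (w' \<bullet> w)) k ?X y
        = ((vassoc_inv A w'' w' w \<triangleleft> ?F) \<parallel> (vassoc A (w'' \<bullet> w') w ?F \<parallel> vassoc A w'' w' (w \<bullet> ?F))) \<parallel>
          ((w'' \<triangleright> (w' \<triangleright> ?\<alpha>)) \<parallel> ((w'' \<triangleright> ?\<alpha>') \<parallel> (?\<alpha>'' \<parallel>
          ((cmp K k \<triangleright> vassoc_inv A v'' v' (v \<bullet> y)) \<parallel> (cmp K k \<triangleright> vassoc_inv A (v'' \<bullet> v') v y)))))"
        unfolding X2 a_bc(2)[OF y] by (simp add: bc(2) glob_assoc hpaste_tail[OF r1])
      also have "\<dots> = retro_component f ((v'' \<bullet> v') \<bullet> v) (w'' \<bullet> (w' \<bullet> w)) k ?Y y"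
        unfolding Y2 ab_c(2)[OF y] r2 r4 
        by (simp add: ab(2) glob_assoc whisk_left_hpaste hpaste_tail[OF r3])
      finally show ?thesis .
    qed
  qed
  then show ?thesis
    by (simp add: \<rho> \<rho>' \<rho>'' retro_vassoc_def retro_hpaste_hcell retro_vpaste_vcell
        del: retro_hpaste.simps retro_vpaste.simps)
qed

end

theorem theorem2p1:
  fixes A :: "('o, 'h, 'v, 'c) dblcat"
    and K :: "('h, 'v, 'c) companions"
  assumes "double_category A"
    and "companion_choice A K"
  shows "double_category (Ret A K)"
proof -
  interpret companion_double_category A K
    using assms by (intro companion_double_category.intro companion_double_category_axioms.intro)
  show ?thesis
  proof (rule double_category.intro, unfold Ret_simps)
    show "\<And>\<alpha> f v w g. cell (Ret A K) \<alpha> f v w g \<Longrightarrow>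
      \<exists>a b c d. harr A f a b \<and> varr A v a c \<and> varr A w b d \<and> harr A g c d"
      by (auto simp: Ret_cell retro_square_iff)
    show "\<And>v a c. varr A v a c \<Longrightarrow> cell (Ret A K) (retro_hidc A v) (hid A a) v v (hid A c)"
      unfolding Ret_cell using retro_hidc_square by blast
    show "\<And>f a b. harr A f a b \<Longrightarrow> cell (Ret A K) (retro_vidc A K f) f (vid A a) (vid A b) f"
      unfolding Ret_cell using retro_vidc_square by blast
    show "\<And>a. a \<in> Obj A \<Longrightarrow> retro_vidc A K (hid A a) = retro_hidc A (vid A a)"
      by (simp add: retro_vidc_def retro_hidc_def)
  qed (fact hdom_obj hcod_obj hid_arr hcomp_arr hcomp_hid hid_hcomp hcomp_assoc
      vdom_obj vcod_obj vid_arr vcomp_arr vcomp_vid vid_vcomp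
      retro_hpaste_cell retro_hidc_hpaste retro_hpaste_assoc
      retro_vpaste_cell retro_vidc_vpaste retro_interchange retro_hidc_vcomp retro_vidc_hcomp
      retro_vassoc_iso retro_vassoc_natural retro_vassoc_vid retro_pentagon)+
qed

end
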